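(* Let $G$ be a finite nonsolvable group. If $G\in\mathcal{D}_4$, then $G\cong\mathrm{A}_5$.
   Context: $\mathcal{D}(G)$ denotes the number of conjugacy classes of nontrivial subgroups $H$ of the finite group $G$ with $N_G(H)\neq H$; $\mathcal{D}_n$ is the family of finite groups $G$ with $\mathcal{D}(G)=n$. *)

theory Defs
  imports "HOL-Algebra.Algebra"
begin

definition subgroup_conj_class :: "('a, 'b) monoid_scheme \<Rightarrow> 'a set \<Rightarrow> 'a set set" where
  "subgroup_conj_class G H = {g <#\<^bsub>G\<^esub> H #>\<^bsub>G\<^esub> inv\<^bsub>G\<^esub> g | g. g \<in> carrier G}"

definition D_num :: "('a, 'b) monoid_scheme \<Rightarrow> nat" where
  "D_num G = card {subgroup_conj_class G H | H.
       subgroup H G \<and> H \<noteq> {\<one>\<^bsub>G\<^esub>} \<and> normalizer G H \<noteq> H}"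

end

theory Submission
  imports Defs "HOL-Number_Theory.Cong"
begin

text \<open>
  The orders of the nontrivial subgroups that are not self-normalizing are at most \<open>D(G)\<close> in number.
  This number of orders drops when a nonsolvable \<open>G\<close> is replaced by a proper derived subgroup, or a
  perfect \<open>G\<close> by its quotient by a nontrivial maximal normal subgroup \<open>M\<close>: the order of the derived
  subgroup, respectively of \<open>M\<close>, is lost.

  Let \<open>G\<close> be nonabelian simple. By Burnside's transfer an abelian Sylow subgroup \<open>P\<close> has \<open>N(P) \<noteq> C(P)\<close>,
  so it is not self-normalizing; neither is any smaller nontrivial \<open>p\<close>-subgroup, because normalizers
  grow in \<open>p\<close>-groups. Hence every prime divisor \<open>p\<close> of \<open>|G|\<close>, and \<open>p\<^sup>2\<close> if it divides \<open>|G|\<close>, is such an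
  order, and the square of the least prime divisor \<open>r\<close> always divides \<open>|G|\<close>. As \<open>|G| = r\<^sup>a q\<close> is
  impossible, there are at least four orders; so a nonsolvable group with \<open>D(G) = 4\<close> is simple, has
  exactly these four, and its nontrivial subgroups that are not self-normalizing are conjugate as soon
  as they have equal order.

  The Sylow \<open>r\<close>-subgroup \<open>P\<close> has order \<open>r\<^sup>2\<close> or \<open>r\<^sup>3\<close>. In the latter case \<open>N(P) = P\<close>, and the subgroups of
  order \<open>r\<^sup>2\<close> in \<open>P\<close>, being normal in \<open>P\<close> and conjugate in \<open>G\<close>, are conjugate in \<open>N(P)\<close>, hence equal; but
  a nonabelian group of order \<open>r\<^sup>3\<close> has more than one of them. So \<open>|P| = r\<^sup>2\<close>, and a prime \<open>s > r\<close> acts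
  nontrivially on \<open>P\<close>, which forces \<open>r = 2\<close>, \<open>s = 3\<close>; counting Sylow subgroups leaves \<open>|G| = 60\<close> and
  \<open>N(P)\<close> of index 5.
\<close>

hide_const (open) Divisibility.prime

section \<open>Conjugates, normalizers and centralizers\<close>

definition conj_set :: "('a, 'b) monoid_scheme \<Rightarrow> 'a \<Rightarrow> 'a set \<Rightarrow> 'a set" where
  "conj_set G g H = (\<lambda>h. g \<otimes>\<^bsub>G\<^esub> h \<otimes>\<^bsub>G\<^esub> inv\<^bsub>G\<^esub> g) ` H"

definition centralizer :: "('a, 'b) monoid_scheme \<Rightarrow> 'a set \<Rightarrow> 'a set" where
  "centralizer G H = {g \<in> carrier G. \<forall>h\<in>H. g \<otimes>\<^bsub>G\<^esub> h = h \<otimes>\<^bsub>G\<^esub> g}"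

context group
begin

lemma inv_mult_cancel [simp]:
  assumes "g \<in> carrier G" "x \<in> carrier G"
  shows "inv g \<otimes> (g \<otimes> x) = x" "g \<otimes> (inv g \<otimes> x) = x"
  using assms by (simp_all flip: m_assoc)

lemma conj_mult_distrib:
  assumes "g \<in> carrier G" "x \<in> carrier G" "y \<in> carrier G"
  shows "g \<otimes> x \<otimes> inv g \<otimes> (g \<otimes> y \<otimes> inv g) = g \<otimes> (x \<otimes> y) \<otimes> inv g"
  using assms by (simp add: m_assoc)

lemma conj_eq_self_iff:
  assumes "g \<in> carrier G" "x \<in> carrier G"
  shows "g \<otimes> x \<otimes> inv g = x \<longleftrightarrow> g \<otimes> x = x \<otimes> g"
  using assms by (intro inv_solve_right') auto

lemma conj_set_eq_cosets: "conj_set G g H = g <# H #> inv g"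
  by (auto simp: conj_set_def l_coset_def r_coset_def)

lemma conj_set_one [simp]: "H \<subseteq> carrier G \<Longrightarrow> conj_set G \<one> H = H"
  by (force simp: conj_set_def)

lemma conj_set_mult:
  assumes "H \<subseteq> carrier G" "g \<in> carrier G" "h \<in> carrier G"
  shows "conj_set G g (conj_set G h H) = conj_set G (g \<otimes> h) H"
  unfolding conj_set_def image_image
  using assms by (intro image_cong) (auto simp: inv_mult_group m_assoc subset_iff)

lemma conj_set_subset_carrier:
  "H \<subseteq> carrier G \<Longrightarrow> g \<in> carrier G \<Longrightarrow> conj_set G g H \<subseteq> carrier G"
  by (auto simp: conj_set_def)

lemma conj_set_inv [simp]:
  assumes "H \<subseteq> carrier G" "g \<in> carrier G"
  shows "conj_set G (inv g) (conj_set G g H) = H" "conj_set G g (conj_set G (inv g) H) = H"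
  using assms by (simp_all add: conj_set_mult)

lemma conj_set_mono: "H \<subseteq> K \<Longrightarrow> conj_set G g H \<subseteq> conj_set G g K"
  by (auto simp: conj_set_def)

lemma conj_set_subset_iff:
  assumes "H \<subseteq> carrier G" "K \<subseteq> carrier G" "g \<in> carrier G"
  shows "conj_set G g H \<subseteq> K \<longleftrightarrow> H \<subseteq> conj_set G (inv g) K"
  using assms conj_set_mono conj_set_inv by (metis inv_closed)

lemma card_conj_set [simp]:
  "H \<subseteq> carrier G \<Longrightarrow> g \<in> carrier G \<Longrightarrow> card (conj_set G g H) = card H"
  unfolding conj_set_def by (rule card_image) (auto simp: inj_on_def subset_iff)

lemma subgroup_conj_set:
  "subgroup H G \<Longrightarrow> g \<in> carrier G \<Longrightarrow> subgroup (conj_set G g H) G"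
  unfolding conj_set_eq_cosets by (rule subgroup_conjugation_is_surj2)

lemma conj_set_self: "subgroup H G \<Longrightarrow> g \<in> H \<Longrightarrow> conj_set G g H = H"
  by (simp add: conj_set_eq_cosets coset_join2 coset_join3 subgroup.mem_carrier subgroup.m_inv_closed
      subgroup.subset)

lemma mem_normalizer:
  "H \<subseteq> carrier G \<Longrightarrow> g \<in> normalizer G H \<longleftrightarrow> g \<in> carrier G \<and> conj_set G g H = H"
  by (simp add: normalizer_def stabilizer_def conj_set_eq_cosets)

lemma subgroup_subset_normalizer: "subgroup H G \<Longrightarrow> H \<subseteq> normalizer G H"
  by (auto simp: mem_normalizer subgroup.subset conj_set_self subgroup.mem_carrier)

lemma normal_iff_normalizer: "H \<lhd> G \<longleftrightarrow> subgroup H G \<and> normalizer G H = carrier G"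
proof
  assume "H \<lhd> G"
  then interpret normal H G .
  have sub: "conj_set G g H \<subseteq> H" if "g \<in> carrier G" for g
    using inv_op_closed2 that by (auto simp: conj_set_def)
  have "conj_set G g H = H" if "g \<in> carrier G" for g
    using sub[OF that] sub[of "inv g"] that by (simp add: conj_set_subset_iff subset subset_antisym)
  then show "subgroup H G \<and> normalizer G H = carrier G"
    using subgroup_axioms by (auto simp: mem_normalizer subset)
next
  assume H: "subgroup H G \<and> normalizer G H = carrier G"
  then have "conj_set G g H = H" if "g \<in> carrier G" for g
    using that mem_normalizer[of H g] by (simp add: subgroup.subset)
  then show "H \<lhd> G"
    using H by (auto simp: normal_inv_iff conj_set_def)
qed

lemma subgroup_centralizer:
  assumes "H \<subseteq> carrier G"
  shows "subgroup (centralizer G H) G"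
proof (rule subgroupI)
  show "inv a \<in> centralizer G H" if "a \<in> centralizer G H" for a
  proof -
    have "inv a \<otimes> h = h \<otimes> inv a" if "h \<in> H" for h
    proof -
      have "a \<in> carrier G" "h \<in> carrier G" "a \<otimes> h = h \<otimes> a"
        using \<open>a \<in> centralizer G H\<close> that assms by (auto simp: centralizer_def)
      then show ?thesis by (metis inv_closed inv_solve_left' inv_solve_right m_assoc m_closed)
    qed
    then show ?thesis using that by (auto simp: centralizer_def)
  qed
  show "a \<otimes> b \<in> centralizer G H" if "a \<in> centralizer G H" "b \<in> centralizer G H" for a b
    using that assms by (auto simp: centralizer_def subset_iff) (metis m_assoc)
qed (use assms in \<open>auto simp: centralizer_def subset_iff intro!: exI[of _ \<one>]\<close>)

lemma centralizer_subset_normalizer: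
  assumes "H \<subseteq> carrier G"
  shows "centralizer G H \<subseteq> normalizer G H"
proof
  fix g assume g: "g \<in> centralizer G H"
  then have "g \<otimes> h \<otimes> inv g = h" if "h \<in> H" for h
    using that assms by (subst conj_eq_self_iff) (auto simp: centralizer_def)
  then have "conj_set G g H = H" by (auto simp: conj_set_def)
  then show "g \<in> normalizer G H" using g assms by (auto simp: mem_normalizer centralizer_def)
qed

lemma subset_centralizer_commute:
  "A \<subseteq> carrier G \<Longrightarrow> B \<subseteq> carrier G \<Longrightarrow> A \<subseteq> centralizer G B \<longleftrightarrow> B \<subseteq> centralizer G A"
  by (auto simp: centralizer_def subset_iff)

lemma conj_set_restrict:
  "subgroup H G \<Longrightarrow> g \<in> H \<Longrightarrow> conj_set (G\<lparr>carrier := H\<rparr>) g K = conj_set G g K"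
  by (simp add: conj_set_def m_inv_consistent)

lemma normalizer_restrict:
  assumes "subgroup H G" "K \<subseteq> H"
  shows "normalizer (G\<lparr>carrier := H\<rparr>) K = H \<inter> normalizer G K"
proof -
  interpret H: group "G\<lparr>carrier := H\<rparr>" by (rule subgroup_imp_group[OF assms(1)])
  show ?thesis
    using assms H.mem_normalizer[of K] mem_normalizer[of K] subgroup.subset[OF assms(1)]
    by (auto simp: conj_set_restrict)
qed

lemma subgroup_restrict_iff:
  assumes "subgroup H G"
  shows "subgroup K (G\<lparr>carrier := H\<rparr>) \<longleftrightarrow> subgroup K G \<and> K \<subseteq> H"
  using incl_subgroup[OF assms] subgroup_incl[OF _ assms] subgroup.subset[of K "G\<lparr>carrier := H\<rparr>"]
  by auto

lemma r_coset_fixed_iff: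
  assumes "subgroup K G" "T \<subseteq> carrier G" "x \<in> carrier G"
  shows "(\<forall>t\<in>T. K #> x #> t = K #> x) \<longleftrightarrow> conj_set G x T \<subseteq> K"
proof -
  have "K #> x #> t = K #> x \<longleftrightarrow> x \<otimes> t \<otimes> inv x \<in> K" if "t \<in> T" for t
  proof -
    have [simp]: "t \<in> carrier G" using that assms by auto
    have "K #> x #> t = K #> (x \<otimes> t)"
      using assms by (simp add: coset_mult_assoc subgroup.subset)
    also have "\<dots> = K #> x \<longleftrightarrow> x \<otimes> t \<in> K #> x"
      using assms repr_independence[of "x \<otimes> t" K x] rcos_self[of "x \<otimes> t" K] by auto
    also have "\<dots> \<longleftrightarrow> x \<otimes> t \<otimes> inv x \<in> K"
      using assms by (simp add: subgroup.rcos_module[OF assms(1)])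
    finally show ?thesis .
  qed
  then show ?thesis by (auto simp: conj_set_def)
qed

lemma r_coset_closed:
  assumes "H \<subseteq> carrier G" "c \<in> rcosets H" "g \<in> carrier G"
  shows "c #> g \<in> rcosets H"
  using assms by (auto simp: RCOSETS_def coset_mult_assoc)

lemma card_rcosets_eq_1_iff:
  assumes "subgroup H G" "finite (carrier G)"
  shows "card (rcosets H) = 1 \<longleftrightarrow> H = carrier G"
  using lagrange[OF assms(1)] assms(2) subgroup.subset[OF assms(1)] card_subset_eq[of "carrier G" H]
    order_gt_0_iff_finite by (auto simp: order_def)

end

section \<open>Actions of p-groups\<close>

context group_action
begin

lemma p_group_orbit_cases:
  assumes "prime p" "order G = p ^ n" "x \<in> E"
  shows "p dvd card (orbit G \<phi> x) \<or> card (orbit G \<phi> x) = 1"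
proof -
  have "card (orbit G \<phi> x) dvd p ^ n"
    using orbit_stabilizer_theorem[OF assms(3)] assms(2) by (metis dvd_triv_left)
  then obtain k where "card (orbit G \<phi> x) = p ^ k"
    using assms(1) by (auto simp: divides_primepow_nat)
  then show ?thesis by (cases k) auto
qed

lemma p_group_fixed_points_cong:
  assumes "prime p" "order G = p ^ n" "finite E"
  shows "[card E = card {x \<in> E. \<forall>g\<in>carrier G. \<phi> g x = x}] (mod p)"
proof -
  interpret group_hom G "BijGroup E" \<phi> by (rule group_hom)
  let ?O = "orbits G E \<phi>" and ?F = "{x \<in> E. \<forall>g\<in>carrier G. \<phi> g x = x}"
  have fin: "finite ?O" using assms(3) by (simp add: orbits_def)
  have singletons: "{b \<in> ?O. card b = 1} = (\<lambda>x. {x}) ` ?F"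
  proof
    show "{b \<in> ?O. card b = 1} \<subseteq> (\<lambda>x. {x}) ` ?F"
    proof
      fix b assume b: "b \<in> {b \<in> ?O. card b = 1}"
      then obtain x where x: "x \<in> E" "b = orbit G \<phi> x" by (auto simp: orbits_def)
      then have "b = {x}"
        using orbit_refl[OF x(1)] b by (auto simp: card_1_singleton_iff)
      then show "b \<in> (\<lambda>x. {x}) ` ?F" using x by (auto simp: orbit_def)
    qed
    have "orbit G \<phi> x = {x}" if "x \<in> ?F" for x
      using that orbit_refl[of x] by (auto simp: orbit_def)
    then show "(\<lambda>x. {x}) ` ?F \<subseteq> {b \<in> ?O. card b = 1}" by (force simp: orbits_def)
  qed
  have "card E = (\<Sum>b\<in>?O. card b)"
    using disjoint_sum[OF assms(3), of "\<lambda>_. 1::nat"] by simp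
  also have "[\<dots> = (\<Sum>b\<in>?O. if card b = 1 then 1 else 0)] (mod p)"
    using p_group_orbit_cases[OF assms(1,2)]
    by (intro cong_sum) (auto simp: cong_0_iff orbits_def)
  also have "(\<Sum>b\<in>?O. if card b = 1 then 1 else 0) = card {b \<in> ?O. card b = 1}"
    using fin by (simp add: sum.If_cases Int_def)
  also have "\<dots> = card ?F"
    unfolding singletons by (simp add: card_image)
  finally show ?thesis .
qed

lemma p_subgroup_fixed_points_cong:
  assumes "prime p" "subgroup T G" "card T = p ^ n" "finite E"
  shows "[card E = card {x \<in> E. \<forall>g\<in>T. \<phi> g x = x}] (mod p)"
proof -
  interpret T: group_action "G\<lparr>carrier := T\<rparr>" E \<phi> by (rule induced_action[OF assms(2)])
  show ?thesis using T.p_group_fixed_points_cong[OF assms(1) _ assms(4)] assms(3)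
    by (simp add: order_def)
qed

end

context group
begin

lemma group_actionI:
  assumes closed: "\<And>g x. g \<in> carrier G \<Longrightarrow> x \<in> E \<Longrightarrow> act g x \<in> E"
    and one: "\<And>x. x \<in> E \<Longrightarrow> act \<one> x = x"
    and mult: "\<And>g h x. g \<in> carrier G \<Longrightarrow> h \<in> carrier G \<Longrightarrow> x \<in> E \<Longrightarrow> act (g \<otimes> h) x = act g (act h x)"
  shows "group_action G E (\<lambda>g. \<lambda>x\<in>E. act g x)"
proof -
  have inverse: "act (inv g) (act g x) = x" "act g (act (inv g) x) = x"
    if "g \<in> carrier G" "x \<in> E" for g x
    using that mult[of "inv g" g x] mult[of g "inv g" x] one by auto
  have bij: "restrict (act g) E \<in> Bij E" if "g \<in> carrier G" for g
  proof -
    have "bij_betw (act g) E E"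
      by (rule bij_betwI[where g = "act (inv g)"]) (use that closed inverse in auto)
    then show ?thesis by (simp add: Bij_def)
  qed
  have "(\<lambda>g. restrict (act g) E) \<in> hom G (BijGroup E)"
  proof (rule homI)
    fix g h assume "g \<in> carrier G" "h \<in> carrier G"
    then show "restrict (act (g \<otimes> h)) E = restrict (act g) E \<otimes>\<^bsub>BijGroup E\<^esub> restrict (act h) E"
      using bij mult closed by (auto simp: BijGroup_def compose_def fun_eq_iff)
  qed (use bij in \<open>simp add: BijGroup_def\<close>)
  then show ?thesis
    by (simp add: group_action_def group_hom_def group_hom_axioms_def group_BijGroup is_group)
qed

lemma action_on_rcosets:
  assumes "H \<subseteq> carrier G"
  shows "group_action G (rcosets H) (\<lambda>g. \<lambda>c\<in>rcosets H. c #> inv g)"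
proof (rule group_actionI)
  have sub: "c \<subseteq> carrier G" if "c \<in> rcosets H" for c
    using that r_coset_subset_G[OF assms] unfolding RCOSETS_def by blast
  show "c #> inv \<one> = c" if "c \<in> rcosets H" for c
    using sub[OF that] by simp
  show "c #> inv (g \<otimes> h) = c #> inv h #> inv g"
    if "g \<in> carrier G" "h \<in> carrier G" "c \<in> rcosets H" for g h c
    using that sub by (simp add: inv_mult_group coset_mult_assoc)
qed (use assms r_coset_closed in auto)

lemma action_by_conjugation_of_normalizer:
  assumes "A \<subseteq> carrier G"
  shows "group_action (G\<lparr>carrier := normalizer G A\<rparr>) A (\<lambda>g. \<lambda>x\<in>A. g \<otimes> x \<otimes> inv g)"
proof -
  interpret N: group "G\<lparr>carrier := normalizer G A\<rparr>"
    by (rule subgroup_imp_group[OF normalizer_imp_subgroup[OF assms]])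
  show ?thesis
  proof (rule N.group_actionI)
    show "g \<otimes> x \<otimes> inv g \<in> A" if "g \<in> carrier (G\<lparr>carrier := normalizer G A\<rparr>)" "x \<in> A" for g x
      using that mem_normalizer[OF assms, of g] by (auto simp: conj_set_def)
    show "g \<otimes>\<^bsub>G\<lparr>carrier := normalizer G A\<rparr>\<^esub> h \<otimes> x \<otimes> inv (g \<otimes>\<^bsub>G\<lparr>carrier := normalizer G A\<rparr>\<^esub> h)
        = g \<otimes> (h \<otimes> x \<otimes> inv h) \<otimes> inv g"
      if "g \<in> carrier (G\<lparr>carrier := normalizer G A\<rparr>)" "h \<in> carrier (G\<lparr>carrier := normalizer G A\<rparr>)"
        "x \<in> A" for g h x
      using that mem_normalizer[OF assms] assms by (auto simp: inv_mult_group m_assoc subset_iff)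
  qed (use assms in auto)
qed

end

section \<open>Sylow subgroups\<close>

definition sylow_subgroups :: "('a, 'b) monoid_scheme \<Rightarrow> nat \<Rightarrow> 'a set set" where
  "sylow_subgroups G p = {P. subgroup P G \<and> card P = p ^ multiplicity p (order G)}"

lemma sylow_subgroupsD:
  assumes "P \<in> sylow_subgroups G p"
  shows "subgroup P G" "card P = p ^ multiplicity p (order G)" "P \<subseteq> carrier G"
  using assms subgroup.subset by (auto simp: sylow_subgroups_def)

locale finite_group = group +
  assumes fin [simp]: "finite (carrier G)"
begin

lemma finite_subset_carrier [simp]: "H \<subseteq> carrier G \<Longrightarrow> finite H"
  using finite_subset fin by blast

lemma finite_subgroup [simp]: "subgroup H G \<Longrightarrow> finite H"
  by (simp add: subgroup.subset)

lemma finite_group_restrict: "subgroup H G \<Longrightarrow> finite_group (G\<lparr>carrier := H\<rparr>)"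
  by (simp add: finite_group_def finite_group_axioms_def subgroup_imp_group)

lemma finite_rcosets [simp]: "subgroup H G \<Longrightarrow> finite (rcosets H)"
  by (rule finite_subset[OF rcosets_subset_PowG]) simp_all

lemma card_subgroup_pos [simp]: "subgroup H G \<Longrightarrow> 0 < card H"
  using subgroup.one_closed by (metis card_gt_0_iff empty_iff finite_subgroup)

lemma order_pos [simp]: "0 < order G"
  by (simp add: order_gt_0_iff_finite)

lemma card_one_subgroup_iff: "subgroup H G \<Longrightarrow> card H = 1 \<longleftrightarrow> H = {\<one>}"
  using subgroup.one_closed by (metis card_1_singleton_iff singletonD is_singletonI is_singleton_altdef)

lemma card_subgroup_eq_order_iff: "subgroup H G \<Longrightarrow> card H = order G \<longleftrightarrow> H = carrier G"
  using card_subset_eq[of "carrier G" H] by (auto simp: order_def subgroup.subset)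

lemma card_subgroup_dvd_order: "subgroup H G \<Longrightarrow> card H dvd order G"
  using lagrange dvd_triv_right by metis

lemma lagrange_restrict:
  assumes "subgroup K G" "subgroup H G" "K \<subseteq> H"
  shows "card (rcosets\<^bsub>G\<lparr>carrier := H\<rparr>\<^esub> K) * card K = card H"
proof -
  interpret H: finite_group "G\<lparr>carrier := H\<rparr>" by (rule finite_group_restrict[OF assms(2)])
  show ?thesis using H.lagrange[of K] assms by (simp add: subgroup_restrict_iff order_def)
qed

lemma card_subgroup_dvd:
  "subgroup K G \<Longrightarrow> subgroup H G \<Longrightarrow> K \<subseteq> H \<Longrightarrow> card K dvd card H"
  using lagrange_restrict dvd_triv_right by metis

lemma card_rcosets_mult:
  assumes "subgroup K G" "subgroup H G" "K \<subseteq> H"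
  shows "card (rcosets K) = card (rcosets H) * card (rcosets\<^bsub>G\<lparr>carrier := H\<rparr>\<^esub> K)"
proof -
  have "card (rcosets K) * card K = card (rcosets H) * card (rcosets\<^bsub>G\<lparr>carrier := H\<rparr>\<^esub> K) * card K"
    using lagrange[OF assms(1)] lagrange[OF assms(2)] lagrange_restrict[OF assms]
    by (simp add: mult.assoc)
  then show ?thesis using card_subgroup_pos[OF assms(1)] by simp
qed

lemma normalizer_eqI:
  assumes "H \<subseteq> carrier G" "g \<in> carrier G" "conj_set G g H \<subseteq> H"
  shows "g \<in> normalizer G H"
  using assms card_subset_eq[of H "conj_set G g H"] by (simp add: mem_normalizer)

lemma prime_order_subgroup_subset:
  assumes "subgroup K G" "prime (card K)" "subgroup A G" "x \<in> K" "x \<in> A" "x \<noteq> \<one>"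
  shows "K \<subseteq> A"
proof -
  have inter: "subgroup (K \<inter> A) G" using assms subgroups_Inter_pair by blast
  have "card (K \<inter> A) \<noteq> 1" using card_one_subgroup_iff[OF inter] assms by auto
  moreover have "card (K \<inter> A) dvd card K" using card_subgroup_dvd[OF inter assms(1)] by simp
  ultimately have "card (K \<inter> A) = card K" using assms(2) by (auto simp: prime_nat_iff)
  then show ?thesis using card_subset_eq[of K "K \<inter> A"] assms(1) by auto
qed

lemma coprime_subgroups_inter:
  assumes "subgroup A G" "subgroup B G" "coprime (card A) (card B)"
  shows "A \<inter> B = {\<one>}"
proof -
  have inter: "subgroup (A \<inter> B) G" using subgroups_Inter_pair assms by blast
  have "card (A \<inter> B) dvd card A" "card (A \<inter> B) dvd card B"
    using card_subgroup_dvd[OF inter] assms by auto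
  then have "card (A \<inter> B) = 1" using assms(3) coprime_common_divisor_nat by blast
  then show ?thesis using card_one_subgroup_iff[OF inter] by blast
qed

lemma exists_prime_power_subgroup:
  assumes "prime p" "p ^ n dvd order G"
  obtains K where "subgroup K G" "card K = p ^ n"
proof -
  obtain m where "order G = p ^ n * m" using assms(2) by auto
  then show ?thesis using sylow_thm[OF assms(1) is_group, of n m] that by auto
qed

lemma exists_prime_power_subgroup_subset:
  assumes "prime p" "subgroup H G" "p ^ n dvd card H"
  obtains K where "subgroup K G" "K \<subseteq> H" "card K = p ^ n"
proof -
  interpret H: finite_group "G\<lparr>carrier := H\<rparr>" by (rule finite_group_restrict[OF assms(2)])
  show ?thesis
    using H.exists_prime_power_subgroup[OF assms(1)] assms that
    by (auto simp: order_def subgroup_restrict_iff)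
qed

lemma prime_power_subgroup_card:
  assumes "prime p" "subgroup H G" "subgroup K G" "K \<subseteq> H" "card H = p ^ n"
  obtains k where "k \<le> n" "card K = p ^ k"
  using card_subgroup_dvd[OF assms(3,2,4)] assms(1,5) by (auto simp: divides_primepow_nat)

lemma p_subgroup_nontrivial:
  assumes "prime p" "subgroup K G" "card K = p ^ n" "n > 0"
  shows "K \<noteq> {\<one>}"
  using card_one_subgroup_iff[OF assms(2)] prime_power_eq_one_iff[OF assms(1), of n] assms(3,4) by simp

lemma p_subgroup_rcosets_cong:
  assumes "prime p" "subgroup H G" "subgroup T G" "card T = p ^ n"
  shows "[card (rcosets H) = card {c \<in> rcosets H. \<forall>t\<in>T. c #> t = c}] (mod p)"
proof -
  interpret group_action G "rcosets H" "\<lambda>g. \<lambda>c\<in>rcosets H. c #> inv g"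
    by (rule action_on_rcosets[OF subgroup.subset[OF assms(2)]])
  have "(\<forall>t\<in>T. c #> inv t = c) \<longleftrightarrow> (\<forall>t\<in>T. c #> t = c)" for c
    using subgroup.m_inv_closed[OF assms(3)] subgroup.subset[OF assms(3)] by (metis inv_inv subsetD)
  then show ?thesis
    using p_subgroup_fixed_points_cong[OF assms(1,3,4)] assms(2) by (simp cong: conj_cong)
qed

lemma p_subgroup_conj_fixed_cong:
  assumes "prime p" "subgroup T G" "card T = p ^ n" "A \<subseteq> carrier G" "T \<subseteq> normalizer G A"
  shows "[card A = card (A \<inter> centralizer G T)] (mod p)"
proof -
  interpret group_action "G\<lparr>carrier := normalizer G A\<rparr>" A "\<lambda>g. \<lambda>x\<in>A. g \<otimes> x \<otimes> inv g"
    by (rule action_by_conjugation_of_normalizer[OF assms(4)])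
  have "{x \<in> A. \<forall>g\<in>T. (\<lambda>x\<in>A. g \<otimes> x \<otimes> inv g) x = x} = A \<inter> centralizer G T"
  proof -
    have "g \<otimes> x \<otimes> inv g = x \<longleftrightarrow> x \<otimes> g = g \<otimes> x" if "g \<in> T" "x \<in> A" for g x
      using that assms(4) subgroup.subset[OF assms(2)] by (subst conj_eq_self_iff) auto
    then show ?thesis using assms(4) by (auto simp: centralizer_def)
  qed
  then show ?thesis
    using p_subgroup_fixed_points_cong[OF assms(1) _ assms(3)] assms(2,4,5)
    by (simp add: subgroup_restrict_iff normalizer_imp_subgroup)
qed

lemma p_subgroup_normalizer_index_cong:
  assumes "prime p" "subgroup K G" "card K = p ^ n"
  shows "[card (rcosets K) = card (rcosets\<^bsub>G\<lparr>carrier := normalizer G K\<rparr>\<^esub> K)] (mod p)"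
proof -
  have K_carrier: "K \<subseteq> carrier G" by (rule subgroup.subset[OF assms(2)])
  have "(\<forall>t\<in>K. K #> x #> t = K #> x) \<longleftrightarrow> x \<in> normalizer G K" if "x \<in> carrier G" for x
    using that r_coset_fixed_iff[OF assms(2) K_carrier that] normalizer_eqI[OF K_carrier that]
      mem_normalizer[OF K_carrier]
    by auto
  then have "{c \<in> rcosets K. \<forall>t\<in>K. c #> t = c} = rcosets\<^bsub>G\<lparr>carrier := normalizer G K\<rparr>\<^esub> K"
    using mem_normalizer[OF K_carrier] by (auto simp: RCOSETS_def)
  then show ?thesis using p_subgroup_rcosets_cong[OF assms(1,2,2,3)] by simp
qed

lemma p_group_normalizer_grows:
  assumes "prime p" "order G = p ^ n" "subgroup D G" "D \<noteq> carrier G"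
  shows "normalizer G D \<noteq> D"
proof
  assume N: "normalizer G D = D"
  have "card (rcosets D) dvd p ^ n" "card (rcosets D) \<noteq> 1"
    using lagrange[OF assms(3)] assms(2) card_rcosets_eq_1_iff[OF assms(3)] assms(4)
    by (auto dest: sym dvdI)
  then have "p dvd card (rcosets D)" using assms(1) by (auto simp: divides_primepow_nat gr0_conv_Suc)
  obtain d where "card D = p ^ d"
    using card_subgroup_dvd_order[OF assms(3)] assms(1,2) by (auto simp: divides_primepow_nat)
  then have "[card (rcosets D) = card (rcosets\<^bsub>G\<lparr>carrier := D\<rparr>\<^esub> D)] (mod p)"
    using p_subgroup_normalizer_index_cong[OF assms(1,3)] N by simp
  moreover have "card (rcosets\<^bsub>G\<lparr>carrier := D\<rparr>\<^esub> D) = 1"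
    using lagrange_restrict[OF assms(3,3)] card_subgroup_pos[OF assms(3)] by simp
  ultimately have "p dvd 1" using \<open>p dvd card (rcosets D)\<close> cong_dvd_iff by metis
  then show False using assms(1) by simp
qed

lemma p_subgroup_normalizer_grows:
  assumes "prime p" "subgroup P G" "card P = p ^ n" "subgroup D G" "D \<subset> P"
  shows "D \<subset> P \<inter> normalizer G D"
proof -
  interpret P: finite_group "G\<lparr>carrier := P\<rparr>" by (rule finite_group_restrict[OF assms(2)])
  have "P \<inter> normalizer G D \<noteq> D"
    using P.p_group_normalizer_grows[OF assms(1) _ _, of n D] assms
    by (simp add: order_def subgroup_restrict_iff normalizer_restrict psubset_eq)
  then show ?thesis using assms(5) subgroup_subset_normalizer[OF assms(4)] by blast
qed

lemma p_subgroup_index_prime_normal: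
  assumes "prime p" "subgroup P G" "card P = p ^ Suc n" "subgroup D G" "D \<subseteq> P" "card D = p ^ n"
  shows "P \<subseteq> normalizer G D"
proof -
  have p: "p > 1" using assms(1) by (rule prime_gt_1_nat)
  have inter: "subgroup (P \<inter> normalizer G D) G"
    using subgroups_Inter_pair[OF assms(2) normalizer_imp_subgroup[OF subgroup.subset[OF assms(4)]]] .
  obtain k where k: "k \<le> Suc n" "card (P \<inter> normalizer G D) = p ^ k"
    using prime_power_subgroup_card[OF assms(1,2) inter _ assms(3)] by blast
  have "D \<subset> P" using assms(3,5,6) p by auto
  then have "card D < card (P \<inter> normalizer G D)"
    using inter by (intro psubset_card_mono p_subgroup_normalizer_grows[OF assms(1-4)]) auto
  then have "n < k" using k(2) assms(6) p by simp
  then have "k = Suc n" using k(1) by linarith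
  then have "card (P \<inter> normalizer G D) = card P" using k(2) assms(3) by simp
  then have "P \<inter> normalizer G D = P" using assms(2) by (intro card_subset_eq) auto
  then show ?thesis by blast
qed

lemma exists_sylow_subgroup:
  assumes "prime p"
  obtains P where "P \<in> sylow_subgroups G p"
  using exists_prime_power_subgroup[OF assms multiplicity_dvd] by (auto simp: sylow_subgroups_def)

lemma not_dvd_sylow_index:
  assumes "prime p" "P \<in> sylow_subgroups G p"
  shows "\<not> p dvd card (rcosets P)"
proof
  note P = sylow_subgroupsD[OF assms(2)]
  assume "p dvd card (rcosets P)"
  then have "p * card P dvd order G" using lagrange[OF P(1)] by (metis dvd_refl mult_dvd_mono)
  then have "p ^ Suc (multiplicity p (order G)) dvd order G" by (simp add: P(2))
  then show False
    using assms(1) order_pos not_prime_unit power_dvd_iff_le_multiplicity[of "order G" p]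
    by (metis Suc_n_not_le_n less_numeral_extra(3))
qed

lemma p_subgroup_conj_subset_sylow:
  assumes "prime p" "P \<in> sylow_subgroups G p" "subgroup T G" "card T = p ^ n"
  obtains x where "x \<in> carrier G" "conj_set G x T \<subseteq> P"
proof -
  note P = sylow_subgroupsD[OF assms(2)]
  have "{c \<in> rcosets P. \<forall>t\<in>T. c #> t = c} \<noteq> {}"
    using p_subgroup_rcosets_cong[OF assms(1) P(1) assms(3,4)] not_dvd_sylow_index[OF assms(1,2)]
    by (metis card.empty cong_0_iff)
  then obtain x where "x \<in> carrier G" "\<forall>t\<in>T. P #> x #> t = P #> x"
    by (auto simp: RCOSETS_def)
  then show ?thesis using that r_coset_fixed_iff[OF P(1) subgroup.subset[OF assms(3)]] by blast
qed

lemma conj_set_sylow: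
  "P \<in> sylow_subgroups G p \<Longrightarrow> g \<in> carrier G \<Longrightarrow> conj_set G g P \<in> sylow_subgroups G p"
  by (auto simp: sylow_subgroups_def subgroup_conj_set subgroup.subset)

lemma p_subgroup_subset_sylow:
  assumes "prime p" "subgroup T G" "card T = p ^ n"
  obtains P where "P \<in> sylow_subgroups G p" "T \<subseteq> P"
proof -
  obtain P where P: "P \<in> sylow_subgroups G p" using exists_sylow_subgroup[OF assms(1)] .
  obtain x where x: "x \<in> carrier G" "conj_set G x T \<subseteq> P"
    using p_subgroup_conj_subset_sylow[OF assms(1) P assms(2,3)] .
  then have "T \<subseteq> conj_set G (inv x) P"
    using conj_set_subset_iff[OF subgroup.subset[OF assms(2)] sylow_subgroupsD(3)[OF P]] by blast
  then show ?thesis using that conj_set_sylow[OF P] x(1) by blast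
qed

lemma sylow_conj:
  assumes "prime p" "P \<in> sylow_subgroups G p" "R \<in> sylow_subgroups G p"
  obtains x where "x \<in> carrier G" "R = conj_set G x P"
proof -
  note P = sylow_subgroupsD[OF assms(2)] and R = sylow_subgroupsD[OF assms(3)]
  obtain x where x: "x \<in> carrier G" "conj_set G x P \<subseteq> R"
    using p_subgroup_conj_subset_sylow[OF assms(1,3) P(1,2)] .
  then have "conj_set G x P = R" using P R by (intro card_subset_eq) auto
  then show ?thesis using that x(1) by blast
qed

lemma sylow_subgroups_restrictI:
  assumes "prime p" "P \<in> sylow_subgroups G p" "subgroup H G" "P \<subseteq> H"
  shows "P \<in> sylow_subgroups (G\<lparr>carrier := H\<rparr>) p"
proof -
  note P = sylow_subgroupsD[OF assms(2)]
  have "multiplicity p (card H) = multiplicity p (order G)"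
  proof (rule antisym)
    show "multiplicity p (card H) \<le> multiplicity p (order G)"
      using card_subgroup_dvd_order[OF assms(3)] by (intro dvd_imp_multiplicity_le) auto
    show "multiplicity p (order G) \<le> multiplicity p (card H)"
      using card_subgroup_dvd[OF P(1) assms(3,4)] P(2) card_subgroup_pos[OF assms(3)]
        not_prime_unit assms(1)
      by (intro multiplicity_geI) auto
  qed
  then show ?thesis
    using P assms(3,4) by (auto simp: sylow_subgroups_def order_def subgroup_restrict_iff)
qed

lemma sylow_conj_in:
  assumes "prime p" "subgroup H G"
    and "P \<in> sylow_subgroups (G\<lparr>carrier := H\<rparr>) p" "R \<in> sylow_subgroups (G\<lparr>carrier := H\<rparr>) p"
  obtains x where "x \<in> H" "R = conj_set G x P"
proof -
  interpret H: finite_group "G\<lparr>carrier := H\<rparr>" by (rule finite_group_restrict[OF assms(2)])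
  show ?thesis
    using H.sylow_conj[OF assms(1,3,4)] that by (auto simp: conj_set_restrict[OF assms(2)])
qed

lemma card_conjugates:
  assumes "H \<subseteq> carrier G"
  shows "card ((\<lambda>g. conj_set G g H) ` carrier G) * card (normalizer G H) = order G"
proof -
  let ?\<phi> = "\<lambda>g. \<lambda>H \<in> {H. H \<subseteq> carrier G}. g <# H #> inv g"
  interpret group_action G "{H. H \<subseteq> carrier G}" ?\<phi>
    by (rule action_by_conjugation_on_power_set)
  have "orbit G ?\<phi> H = (\<lambda>g. conj_set G g H) ` carrier G"
    using assms by (auto simp: orbit_def conj_set_eq_cosets)
  then show ?thesis
    using orbit_stabilizer_theorem[of H] assms by (simp add: normalizer_def)
qed

lemma card_sylow_subgroups:
  assumes "prime p" "P \<in> sylow_subgroups G p"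
  shows "card (sylow_subgroups G p) * card (normalizer G P) = order G"
proof -
  have "(\<lambda>g. conj_set G g P) ` carrier G = sylow_subgroups G p"
    using conj_set_sylow[OF assms(2)] sylow_conj[OF assms] by blast
  then show ?thesis using card_conjugates[OF sylow_subgroupsD(3)[OF assms(2)]] by simp
qed

lemma card_sylow_subgroups_cong:
  assumes "prime p"
  shows "[card (sylow_subgroups G p) = 1] (mod p)"
proof -
  obtain P where P: "P \<in> sylow_subgroups G p" using exists_sylow_subgroup[OF assms] .
  note P_sylow = sylow_subgroupsD[OF P]
  let ?N = "normalizer G P" and ?k = "card (rcosets\<^bsub>G\<lparr>carrier := normalizer G P\<rparr>\<^esub> P)"
  have N: "subgroup ?N G" by (rule normalizer_imp_subgroup[OF P_sylow(3)])
  have "card (rcosets ?N) = card (sylow_subgroups G p)"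
    using card_sylow_subgroups[OF assms P] lagrange[OF N] card_subgroup_pos[OF N]
    by (metis less_numeral_extra(3) mult_cancel2)
  then have index: "card (rcosets P) = card (sylow_subgroups G p) * ?k"
    using card_rcosets_mult[OF P_sylow(1) N subgroup_subset_normalizer[OF P_sylow(1)]] by simp
  then have "[card (sylow_subgroups G p) * ?k = 1 * ?k] (mod p)"
    using p_subgroup_normalizer_index_cong[OF assms P_sylow(1,2)] by simp
  moreover have "\<not> p dvd ?k" using not_dvd_sylow_index[OF assms P] index by auto
  then have "coprime ?k p" using prime_imp_coprime[OF assms] coprime_commute by blast
  ultimately show ?thesis using cong_mult_rcancel_nat by blast
qed

lemma normal_subsets_of_sylow_conj:
  assumes "prime p" and P: "P \<in> sylow_subgroups G p" and A: "A \<subseteq> carrier G"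
    and g: "g \<in> carrier G" and norm: "P \<subseteq> normalizer G A" "P \<subseteq> normalizer G (conj_set G g A)"
  obtains n where "n \<in> normalizer G P" "conj_set G g A = conj_set G n A"
proof -
  let ?B = "conj_set G g A"
  note P_carrier = sylow_subgroupsD(3)[OF P]
  have B: "?B \<subseteq> carrier G" using A g by (rule conj_set_subset_carrier)
  have N: "subgroup (normalizer G ?B) G" by (rule normalizer_imp_subgroup[OF B])
  have "conj_set G g P \<subseteq> normalizer G ?B"
  proof
    fix y assume "y \<in> conj_set G g P"
    then obtain x where x: "x \<in> P" "y = g \<otimes> x \<otimes> inv g" by (auto simp: conj_set_def)
    then have "x \<in> carrier G" "conj_set G x A = A" using norm(1) mem_normalizer[OF A] by auto
    then have "conj_set G y ?B = ?B"
      using x(2) A g by (simp add: conj_set_mult conj_set_mult[symmetric, of A g x] m_assoc)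
    then show "y \<in> normalizer G ?B" using x(2) g \<open>x \<in> carrier G\<close> mem_normalizer[OF B] by simp
  qed
  then obtain n where n: "n \<in> normalizer G ?B" "P = conj_set G n (conj_set G g P)"
    using sylow_conj_in[OF assms(1) N] sylow_subgroups_restrictI[OF assms(1) _ N] P norm(2)
      conj_set_sylow[OF P g] by metis
  then have n_facts: "n \<in> carrier G" "conj_set G n ?B = ?B" using mem_normalizer[OF B] by auto
  have "n \<otimes> g \<in> normalizer G P" using n(2) n_facts(1) g P_carrier
    by (simp add: mem_normalizer conj_set_mult)
  moreover have "?B = conj_set G (n \<otimes> g) A" using n_facts g A by (simp add: conj_set_mult)
  ultimately show ?thesis using that by blast
qed

lemma finite_sylow_subgroups [simp]: "finite (sylow_subgroups G p)"
  by (rule finite_subset[of _ "Pow (carrier G)"]) (auto dest: sylow_subgroupsD(3))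

lemma normalizer_unique_sylow_subgroup:
  assumes "prime p" "sylow_subgroups G p = {P}"
  shows "normalizer G P = carrier G"
  using card_sylow_subgroups[OF assms(1), of P] assms(2) normalizer_imp_subgroup[of P]
    card_subgroup_eq_order_iff[of "normalizer G P"] sylow_subgroupsD(3)[of P G p] by simp

lemma normal_Inter_sylow_subgroups:
  assumes "prime p"
  shows "\<Inter>(sylow_subgroups G p) \<lhd> G"
proof (rule normal_invI)
  obtain P where "P \<in> sylow_subgroups G p" using exists_sylow_subgroup[OF assms] .
  then show "subgroup (\<Inter>(sylow_subgroups G p)) G"
    by (intro subgroups_Inter) (auto dest: sylow_subgroupsD(1))
  fix x h assume x: "x \<in> carrier G" and h: "h \<in> \<Inter>(sylow_subgroups G p)"
  show "x \<otimes> h \<otimes> inv x \<in> \<Inter>(sylow_subgroups G p)"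
  proof
    fix P assume P: "P \<in> sylow_subgroups G p"
    note P_carrier = sylow_subgroupsD(3)[OF P]
    have "h \<in> conj_set G (inv x) P" using h conj_set_sylow[OF P] x by auto
    then have "x \<otimes> h \<otimes> inv x \<in> conj_set G x (conj_set G (inv x) P)" by (auto simp: conj_set_def)
    then show "x \<otimes> h \<otimes> inv x \<in> P" using P_carrier x by simp
  qed
qed

lemma normalizer_maximal_sylow_inter:
  assumes p: "prime p" and P: "P \<in> sylow_subgroups G p" and R: "R \<in> sylow_subgroups G p" and "P \<noteq> R"
    and max: "\<And>A B. A \<in> sylow_subgroups G p \<Longrightarrow> B \<in> sylow_subgroups G p \<Longrightarrow> A \<noteq> B \<Longrightarrow>
      card (A \<inter> B) \<le> card (P \<inter> R)"
  shows "card (normalizer G (P \<inter> R)) \<noteq> p ^ n"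
proof
  let ?D = "P \<inter> R" and ?N = "normalizer G (P \<inter> R)"
  have D: "subgroup ?D G" using subgroups_Inter_pair sylow_subgroupsD(1) P R by blast
  have N: "subgroup ?N G" by (rule normalizer_imp_subgroup[OF subgroup.subset[OF D]])
  have "card P = card R" using sylow_subgroupsD(2) P R by metis
  then have incomparable: "\<not> P \<subseteq> R" "\<not> R \<subseteq> P"
    using card_subset_eq[of R P] card_subset_eq[of P R] finite_subgroup[OF sylow_subgroupsD(1)] P R
      \<open>P \<noteq> R\<close> by auto
  assume "card ?N = p ^ n"
  then obtain S where S: "S \<in> sylow_subgroups G p" "?N \<subseteq> S" using p_subgroup_subset_sylow[OF p N]
    by blast
  have "Q = S" if cases: "Q = P \<or> Q = R" for Q
  proof (rule ccontr)
    assume "Q \<noteq> S"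
    have Q_sylow: "Q \<in> sylow_subgroups G p" using cases P R by blast
    note Q_facts = sylow_subgroupsD[OF Q_sylow]
    have "?D \<subset> Q" using cases incomparable by blast
    then have "?D \<subset> Q \<inter> ?N" by (rule p_subgroup_normalizer_grows[OF p Q_facts(1,2) D])
    then have "card ?D < card (Q \<inter> S)" using S(2) Q_facts(3) by (intro psubset_card_mono) auto
    then show False using max[OF Q_sylow S(1) \<open>Q \<noteq> S\<close>] by simp
  qed
  then show False using \<open>P \<noteq> R\<close> by blast
qed

lemma exists_maximal_sylow_inter:
  assumes "P \<in> sylow_subgroups G p" "R \<in> sylow_subgroups G p" "P \<noteq> R"
  obtains A B where "A \<in> sylow_subgroups G p" "B \<in> sylow_subgroups G p" "A \<noteq> B"
    and "\<And>C D. C \<in> sylow_subgroups G p \<Longrightarrow> D \<in> sylow_subgroups G p \<Longrightarrow> C \<noteq> D \<Longrightarrow>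
      card (C \<inter> D) \<le> card (A \<inter> B)"
proof -
  let ?S = "{(A, B) \<in> sylow_subgroups G p \<times> sylow_subgroups G p. A \<noteq> B}"
  let ?f = "\<lambda>(A, B). card (A \<inter> B)"
  have "finite ?S"
    by (rule finite_subset[of _ "sylow_subgroups G p \<times> sylow_subgroups G p"]) auto
  then have fin: "finite (?f ` ?S)" by (rule finite_imageI)
  moreover have "?f ` ?S \<noteq> {}" using assms by blast
  ultimately have "Max (?f ` ?S) \<in> ?f ` ?S" by (rule Max_in)
  then obtain z where z: "z \<in> ?S" "?f z = Max (?f ` ?S)" by (metis (no_types, lifting) imageE)
  obtain A B where "z = (A, B)" by (rule prod.exhaust)
  then have AB: "A \<in> sylow_subgroups G p" "B \<in> sylow_subgroups G p" "A \<noteq> B"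
      "card (A \<inter> B) = Max (?f ` ?S)"
    using z by simp_all
  have "card (C \<inter> D) \<le> card (A \<inter> B)"
    if "C \<in> sylow_subgroups G p" "D \<in> sylow_subgroups G p" "C \<noteq> D" for C D
  proof -
    have "?f (C, D) \<in> ?f ` ?S" using that by (intro imageI) simp
    then show ?thesis using Max_ge[OF fin] AB(4) by fastforce
  qed
  then show ?thesis by (rule that[OF AB(1-3)])
qed

lemma subgroup_subset_if_sylow_subgroups_subset:
  assumes "subgroup H G" "subgroup C G"
    and sylow: "\<And>q. prime q \<Longrightarrow> q dvd card H \<Longrightarrow> \<exists>T\<in>sylow_subgroups (G\<lparr>carrier := H\<rparr>) q. T \<subseteq> C"
  shows "H \<subseteq> C"
proof -
  have inter: "subgroup (H \<inter> C) G" using subgroups_Inter_pair assms(1,2) by blast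
  have "card H dvd card (H \<inter> C)"
  proof (rule multiplicity_le_imp_dvd)
    show "card H \<noteq> 0" using card_subgroup_pos[OF assms(1)] by simp
    fix q :: nat assume q: "prime q"
    show "multiplicity q (card H) \<le> multiplicity q (card (H \<inter> C))"
    proof (cases "q dvd card H")
      case True
      then obtain T where T: "T \<in> sylow_subgroups (G\<lparr>carrier := H\<rparr>) q" "T \<subseteq> C" using sylow q by blast
      then have "subgroup T G" "T \<subseteq> H" "card T = q ^ multiplicity q (card H)"
        using assms(1) by (auto simp: sylow_subgroups_def subgroup_restrict_iff order_def)
      then have "q ^ multiplicity q (card H) dvd card (H \<inter> C)"
        using card_subgroup_dvd[OF _ inter] T(2) by (metis Int_greatest)
      then show ?thesis using q not_prime_unit card_subgroup_pos[OF inter]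
        by (intro multiplicity_geI) auto
    qed (simp add: not_dvd_imp_multiplicity_0)
  qed
  then have "card H \<le> card (H \<inter> C)" using card_subgroup_pos[OF inter] by (rule dvd_imp_le)
  then have "H \<inter> C = H" using assms(1) by (intro card_seteq) auto
  then show ?thesis by blast
qed

end

section \<open>Groups of small prime power order\<close>

context finite_group
begin

lemma subgroup_inter_centralizer:
  "subgroup H G \<Longrightarrow> K \<subseteq> carrier G \<Longrightarrow> subgroup (H \<inter> centralizer G K) G"
  by (intro subgroups_Inter_pair subgroup_centralizer)

lemma p_group_center_nontrivial:
  assumes "prime p" "subgroup P G" "card P = p ^ n" "n > 0"
  shows "p dvd card (P \<inter> centralizer G P)"
proof -
  have "p dvd card P" using assms(3,4) by simp
  then show ?thesis
    using p_subgroup_conj_fixed_cong[OF assms(1-3) subgroup.subset[OF assms(2)]]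
      subgroup_subset_normalizer[OF assms(2)] cong_dvd_iff by blast
qed

lemma abelian_of_central_index_prime:
  assumes "prime p" "subgroup P G" "subgroup Z G" "Z \<subseteq> P \<inter> centralizer G P" "card P = p * card Z"
  shows "P \<subseteq> centralizer G P"
proof
  fix x assume x: "x \<in> P"
  have P_carrier: "P \<subseteq> carrier G" by (rule subgroup.subset[OF assms(2)])
  show "x \<in> centralizer G P"
  proof (cases "x \<in> Z")
    case True then show ?thesis using assms(4) by auto
  next
    case False
    let ?C = "P \<inter> centralizer G {x}"
    have C: "subgroup ?C G" using subgroup_inter_centralizer[OF assms(2), of "{x}"] x P_carrier by auto
    have "Z \<subset> ?C" using assms(4) x P_carrier False by (auto simp: centralizer_def)
    then obtain k where k: "card ?C = card Z * k" using card_subgroup_dvd[OF assms(3) C] by auto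
    have "card Z < card ?C" using C \<open>Z \<subset> ?C\<close> by (intro psubset_card_mono) auto
    then have "k \<noteq> 1" using k by auto
    moreover have "k dvd p"
      using card_subgroup_dvd[OF C assms(2)] k assms(5) card_subgroup_pos[OF assms(3)]
      by (simp add: mult.commute)
    ultimately have "k = p" using assms(1) by (auto simp: prime_nat_iff)
    then have "?C = P" using k assms(2,5) by (intro card_subset_eq) (auto simp: mult.commute)
    then have "P \<subseteq> centralizer G {x}" by blast
    then show ?thesis using subset_centralizer_commute[of P "{x}"] x P_carrier by auto
  qed
qed

lemma order_prime_abelian:
  assumes "prime p" "subgroup P G" "card P = p"
  shows "P \<subseteq> centralizer G P"
  using abelian_of_central_index_prime[OF assms(1,2) triv_subgroup] assms(2,3)
  by (auto simp: centralizer_def subgroup.one_closed subgroup.mem_carrier)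

lemma order_prime_square_abelian:
  assumes "prime p" "subgroup P G" "card P = p ^ 2"
  shows "P \<subseteq> centralizer G P"
proof -
  have center: "subgroup (P \<inter> centralizer G P) G"
    by (rule subgroup_inter_centralizer[OF assms(2) subgroup.subset[OF assms(2)]])
  obtain Z where "subgroup Z G" "Z \<subseteq> P \<inter> centralizer G P" "card Z = p ^ 1"
    using exists_prime_power_subgroup_subset[OF assms(1) center, of 1] p_group_center_nontrivial[OF assms]
    by auto
  then show ?thesis
    using abelian_of_central_index_prime[OF assms(1,2)] assms(3) by (simp add: power2_eq_square)
qed

lemma card_centralizer_order_prime_cube:
  assumes "prime p" "subgroup P G" "card P = p ^ 3" "x \<in> P" "x \<notin> centralizer G P"
  shows "card (P \<inter> centralizer G {x}) = p ^ 2"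
proof -
  let ?C = "P \<inter> centralizer G {x}" and ?Z = "P \<inter> centralizer G P"
  have p: "p > 1" using assms(1) by (rule prime_gt_1_nat)
  have P_carrier: "P \<subseteq> carrier G" by (rule subgroup.subset[OF assms(2)])
  have C: "subgroup ?C G" and Z: "subgroup ?Z G"
    using subgroup_inter_centralizer[OF assms(2)] assms(4) P_carrier by auto
  obtain k where k: "k \<le> 3" "card ?C = p ^ k"
    using prime_power_subgroup_card[OF assms(1,2) C _ assms(3)] by blast
  have "p \<le> card ?Z" using p_group_center_nontrivial[OF assms(1-3)] Z by (intro dvd_imp_le) auto
  also have "card ?Z < card ?C"
    using assms(4,5) P_carrier C by (intro psubset_card_mono) (auto simp: centralizer_def)
  finally have "p ^ 1 < p ^ k" using k(2) by simp
  then have "1 < k" using p by (simp only: power_strict_increasing_iff)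
  moreover have "k \<noteq> 3"
  proof
    assume "k = 3"
    then have "?C = P" using k(2) assms(2,3) by (intro card_subset_eq) auto
    then have "P \<subseteq> centralizer G {x}" by blast
    then show False using subset_centralizer_commute[of P "{x}"] assms(4,5) P_carrier by auto
  qed
  ultimately show ?thesis using k by (simp add: le_Suc_eq numeral_3_eq_3 numeral_2_eq_2)
qed

lemma order_prime_cube_abelian_if_unique_prime_square_subgroup:
  assumes "prime p" "subgroup P G" "card P = p ^ 3"
    and unique: "\<And>A B. subgroup A G \<Longrightarrow> subgroup B G \<Longrightarrow> A \<subseteq> P \<Longrightarrow> B \<subseteq> P \<Longrightarrow>
      card A = p ^ 2 \<Longrightarrow> card B = p ^ 2 \<Longrightarrow> A = B"
  shows "P \<subseteq> centralizer G P"
proof (rule ccontr)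
  let ?C = "\<lambda>x. P \<inter> centralizer G {x}"
  have p: "p > 1" using assms(1) by (rule prime_gt_1_nat)
  have P_carrier: "P \<subseteq> carrier G" by (rule subgroup.subset[OF assms(2)])
  have C: "subgroup (?C x) G" if "x \<in> P" for x
    using subgroup_inter_centralizer[OF assms(2), of "{x}"] that P_carrier by auto
  assume "\<not> P \<subseteq> centralizer G P"
  then obtain x where x: "x \<in> P" "x \<notin> centralizer G P" by blast
  have "P \<subseteq> ?C x"
  proof
    fix y assume y: "y \<in> P"
    show "y \<in> ?C x"
    proof (cases "y \<in> centralizer G P")
      case True then show ?thesis using x(1) y by (auto simp: centralizer_def)
    next
      case False
      then have "?C y = ?C x"
        using unique[OF C[OF y] C[OF x(1)]] card_centralizer_order_prime_cube[OF assms(1-3)] x y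
        by blast
      then show ?thesis using y P_carrier by (auto simp: centralizer_def)
    qed
  qed
  then have "card P \<le> card (?C x)" using C[OF x(1)] by (intro card_mono) auto
  then show False using card_centralizer_order_prime_cube[OF assms(1-3) x] assms(3) p by simp
qed

lemma self_normalizing_sylow_order_prime_cube_abelian:
  assumes p: "prime p" and P: "P \<in> sylow_subgroups G p" and card: "card P = p ^ 3"
    and self_norm: "normalizer G P = P"
    and conj: "\<And>A B. subgroup A G \<Longrightarrow> subgroup B G \<Longrightarrow> card A = p ^ 2 \<Longrightarrow> card B = p ^ 2 \<Longrightarrow>
      \<exists>g\<in>carrier G. B = conj_set G g A"
  shows "P \<subseteq> centralizer G P"
proof (rule order_prime_cube_abelian_if_unique_prime_square_subgroup[OF p sylow_subgroupsD(1)[OF P] card])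
  fix A B assume AB: "subgroup A G" "subgroup B G" "A \<subseteq> P" "B \<subseteq> P" "card A = p ^ 2" "card B = p ^ 2"
  have normal: "P \<subseteq> normalizer G D" if "subgroup D G" "D \<subseteq> P" "card D = p ^ 2" for D
    using p_subgroup_index_prime_normal[OF p sylow_subgroupsD(1)[OF P] _ that] card
    by (simp add: numeral_3_eq_3 numeral_2_eq_2)
  have A_carrier: "A \<subseteq> carrier G" by (rule subgroup.subset[OF AB(1)])
  obtain g where g: "g \<in> carrier G" "B = conj_set G g A" using conj AB by blast
  then obtain n where "n \<in> normalizer G P" "B = conj_set G n A"
    using normal_subsets_of_sylow_conj[OF p P A_carrier g(1)] normal AB by metis
  moreover have "n \<in> normalizer G A" using calculation(1) self_norm normal AB(1,3,5) by blast
  ultimately show "A = B" using mem_normalizer[OF A_carrier] by simp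
qed

lemma p_subgroup_centralizes_or_dvd:
  assumes "prime q" "subgroup T G" "card T = q ^ m" "prime r" "r \<noteq> q"
    and "subgroup A G" "card A = r ^ n" "T \<subseteq> normalizer G A"
  shows "T \<subseteq> centralizer G A \<or> (\<exists>j\<in>{1..n}. q dvd r ^ j - 1)"
proof -
  let ?F = "A \<inter> centralizer G T"
  have T_carrier: "T \<subseteq> carrier G" and A_carrier: "A \<subseteq> carrier G" using assms subgroup.subset by auto
  have F: "subgroup ?F G" by (rule subgroup_inter_centralizer[OF assms(6) T_carrier])
  obtain k where k: "k \<le> n" "card ?F = r ^ k"
    using prime_power_subgroup_card[OF assms(4,6) F _ assms(7)] by blast
  show ?thesis
  proof (cases "k = n")
    case True
    then have "?F = A" using k(2) assms(6,7) by (intro card_subset_eq) auto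
    then show ?thesis using subset_centralizer_commute[OF A_carrier T_carrier] by blast
  next
    case False
    have "[r ^ n = r ^ k] (mod q)"
      using p_subgroup_conj_fixed_cong[OF assms(1-3) A_carrier assms(8)] assms(7) k(2) by simp
    then have "q dvd r ^ n - r ^ k"
      using k(1) prime_gt_0_nat[OF assms(4)] by (simp add: cong_altdef_nat power_increasing)
    also have "r ^ n - r ^ k = r ^ k * (r ^ (n - k) - 1)"
      using k(1) by (simp add: right_diff_distrib' flip: power_add)
    finally have "q dvd r ^ (n - k) - 1"
      using assms(1,4,5) by (metis prime_dvd_mult_nat prime_dvd_power primes_dvd_imp_eq)
    then show ?thesis using k(1) False by (intro disjI2 bexI[of _ "n - k"]) auto
  qed
qed

end

lemma prime_dvd_prime_square_minus_one:
  fixes q r :: nat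
  assumes "prime q" "prime r" "r < q" "q dvd r ^ 2 - 1"
  shows "r = 2" "q = 3"
proof -
  have r: "r > 1" using assms(2) by (rule prime_gt_1_nat)
  have "r ^ 2 - 1 = (r + 1) * (r - 1)" by (simp add: power2_eq_square algebra_simps)
  then have "q dvd r + 1 \<or> q dvd r - 1" using assms(1,4) prime_dvd_mult_nat by metis
  moreover have "\<not> q dvd r - 1" using r assms(3) by (auto dest!: dvd_imp_le)
  ultimately have "q dvd r + 1" by blast
  then have q: "q = r + 1" using dvd_imp_le[of q "r + 1"] assms(3) by auto
  then show "r = 2" using assms(1,2) r prime_odd_nat[of r] prime_odd_nat[of q] by fastforce
  then show "q = 3" using q by simp
qed

section \<open>Burnside's transfer\<close>

definition transfer :: "('a, 'b) monoid_scheme \<Rightarrow> 'a set \<Rightarrow> ('a set \<Rightarrow> 'a) \<Rightarrow> 'a \<Rightarrow> 'a" where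
  "transfer G H t g =
    finprod (G\<lparr>carrier := H\<rparr>) (\<lambda>c. t c \<otimes>\<^bsub>G\<^esub> g \<otimes>\<^bsub>G\<^esub> inv\<^bsub>G\<^esub> (t (c #>\<^bsub>G\<^esub> g))) (rcosets\<^bsub>G\<^esub> H)"

context group
begin

lemma comm_group_restrict:
  "subgroup H G \<Longrightarrow> H \<subseteq> centralizer G H \<Longrightarrow> comm_group (G\<lparr>carrier := H\<rparr>)"
  by (intro group.group_comm_groupI subgroup_imp_group) (auto simp: centralizer_def)

lemma transfer_factor_closed:
  assumes H: "subgroup H G" and t: "t \<in> (\<Pi> c\<in>rcosets H. c)"
    and "c \<in> rcosets H" "g \<in> carrier G"
  shows "t c \<otimes> g \<otimes> inv (t (c #> g)) \<in> H"
proof -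
  have cg_coset: "c #> g \<in> rcosets H" using assms r_coset_closed subgroup.subset by blast
  have "t c \<otimes> g \<in> c #> g" using Pi_mem[OF t assms(3)] by (auto simp: r_coset_def)
  then show ?thesis using diff_neutralizes[OF H cg_coset] Pi_mem[OF t cg_coset] by blast
qed

lemma transfer_hom:
  assumes H: "subgroup H G" "H \<subseteq> centralizer G H" and t: "t \<in> (\<Pi> c\<in>rcosets H. c)"
  shows "transfer G H t \<in> hom G (G\<lparr>carrier := H\<rparr>)"
proof (rule homI)
  let ?H = "G\<lparr>carrier := H\<rparr>" and ?f = "\<lambda>g c. t c \<otimes> g \<otimes> inv (t (c #> g))"
  interpret H: comm_group ?H by (rule comm_group_restrict[OF H])
  have H_carrier: "H \<subseteq> carrier G" by (rule subgroup.subset[OF H(1)])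
  have coset_carrier: "c \<subseteq> carrier G" if "c \<in> rcosets H" for c
    by (rule subgroup.rcosets_carrier[OF H(1) is_group that])
  have t_carrier: "t c \<in> carrier G" if "c \<in> rcosets H" for c
    using Pi_mem[OF t that] coset_carrier[OF that] by auto
  have factor_closed: "?f g c \<in> H" if "c \<in> rcosets H" "g \<in> carrier G" for g c
    using transfer_factor_closed[OF H(1) t that] .
  note closed = r_coset_closed[OF H_carrier]
  show "transfer G H t g \<in> carrier ?H" if "g \<in> carrier G" for g
    unfolding transfer_def using that by (intro H.finprod_closed) (auto simp: factor_closed)
  fix g h assume gh_mem: "g \<in> carrier G" "h \<in> carrier G"
  have cocycle: "?f (g \<otimes> h) c = ?f g c \<otimes>\<^bsub>?H\<^esub> ?f h (c #> g)" if "c \<in> rcosets H" for c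
    using that gh_mem closed t_carrier coset_carrier[OF that] by (simp add: m_assoc coset_mult_assoc)
  have "transfer G H t (g \<otimes> h) = finprod ?H (\<lambda>c. ?f g c \<otimes>\<^bsub>?H\<^esub> ?f h (c #> g)) (rcosets H)"
    unfolding transfer_def using gh_mem cocycle factor_closed closed subgroup.m_closed[OF H(1)]
    by (intro H.finprod_cong') auto
  also have "\<dots> = transfer G H t g \<otimes>\<^bsub>?H\<^esub> finprod ?H (\<lambda>c. ?f h (c #> g)) (rcosets H)"
    unfolding transfer_def using gh_mem factor_closed closed by (intro H.finprod_multf) auto
  also have "finprod ?H (\<lambda>c. ?f h (c #> g)) (rcosets H) = transfer G H t h"
  proof -
    have "bij_betw (\<lambda>c. c #> g) (rcosets H) (rcosets H)"
      by (rule bij_betwI[where g = "\<lambda>c. c #> inv g"])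
        (use gh_mem closed coset_carrier in \<open>auto simp: coset_mult_assoc\<close>)
    then show ?thesis
      unfolding transfer_def
      using H.finprod_reindex[of "?f h" "\<lambda>c. c #> g" "rcosets H"] gh_mem factor_closed
      by (auto simp: bij_betw_def)
  qed
  finally show "transfer G H t (g \<otimes> h) = transfer G H t g \<otimes>\<^bsub>?H\<^esub> transfer G H t h" .
qed

lemma image_r_coset_subgroup_shift:
  assumes K: "subgroup K G" and c: "c \<subseteq> carrier G" and k: "k \<in> K"
  shows "(\<lambda>l. c #> k #> l) ` K = (\<lambda>l. c #> l) ` K"
proof -
  have shift_subset: "(\<lambda>l. d #> j #> l) ` K \<subseteq> (\<lambda>l. d #> l) ` K" if "d \<subseteq> carrier G" "j \<in> K" for d j
    using that subgroup.mem_carrier[OF K] subgroup.m_closed[OF K] by (auto simp: coset_mult_assoc)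
  have "c #> k \<subseteq> carrier G" "c #> k #> inv k = c"
    using c k subgroup.mem_carrier[OF K] by (simp_all add: r_coset_subset_G coset_mult_assoc)
  then show ?thesis
    using shift_subset[OF c k] shift_subset[of "c #> k" "inv k"] subgroup.m_inv_closed[OF K k] by simp
qed

lemma exists_rcosets_orbit_base:
  assumes H: "subgroup H G" and K: "subgroup K G"
  obtains base offset where "\<And>c. c \<in> rcosets H \<Longrightarrow> base c \<in> rcosets H"
    and "\<And>c. c \<in> rcosets H \<Longrightarrow> offset c \<in> K \<and> base c #> offset c = c"
    and "\<And>c k. c \<in> rcosets H \<Longrightarrow> k \<in> K \<Longrightarrow> base (c #> k) = base c"
proof -
  define base where "base c = (SOME d. d \<in> (\<lambda>k. c #> k) ` K)" for c
  have K_carrier: "k \<in> carrier G" if "k \<in> K" for k by (rule subgroup.mem_carrier[OF K that])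
  have coset_carrier: "c \<subseteq> carrier G" if "c \<in> rcosets H" for c
    by (rule subgroup.rcosets_carrier[OF H is_group that])
  have base: "base c \<in> (\<lambda>k. c #> k) ` K" for c
    unfolding base_def some_in_eq using subgroup.one_closed[OF K] by auto
  have "\<exists>k\<in>K. base c #> k = c" if c: "c \<in> rcosets H" for c
  proof -
    obtain k where "k \<in> K" "base c = c #> k" using base[of c] by auto
    then show ?thesis
      using coset_carrier[OF c] K_carrier subgroup.m_inv_closed[OF K]
      by (intro bexI[of _ "inv k"]) (simp_all add: coset_mult_assoc)
  qed
  then obtain offset where offset: "\<And>c. c \<in> rcosets H \<Longrightarrow> offset c \<in> K \<and> base c #> offset c = c"
    by metis
  have base_coset: "base c \<in> rcosets H" if "c \<in> rcosets H" for c
    using base[of c] r_coset_closed[OF subgroup.subset[OF H] that K_carrier] by auto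
  have base_shift: "base (c #> k) = base c" if "c \<in> rcosets H" "k \<in> K" for c k
    unfolding base_def image_r_coset_subgroup_shift[OF K coset_carrier[OF that(1)] that(2)] ..
  show ?thesis by (rule that[OF base_coset offset base_shift])
qed

lemma r_coset_free_shift_eq:
  assumes d: "d \<subseteq> carrier G" and K: "subgroup K G" and k: "k \<in> K" "u \<in> K" "v \<in> K"
    and free: "\<And>l. l \<in> K \<Longrightarrow> d #> u #> l = d #> u \<Longrightarrow> l = \<one>"
    and eq: "d #> v = d #> u #> k"
  shows "v = u \<otimes> k"
proof -
  have c: "u \<in> carrier G" "v \<in> carrier G" "k \<in> carrier G" using k subgroup.mem_carrier[OF K] by auto
  have "d #> u #> (inv u \<otimes> v \<otimes> inv k) = d #> v #> inv k"
    using d c by (simp add: coset_mult_assoc m_assoc)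
  also have "\<dots> = d #> u" unfolding eq using d c by (simp add: coset_mult_assoc m_assoc)
  finally have "inv u \<otimes> v \<otimes> inv k = \<one>"
    using free subgroup.m_closed[OF K] subgroup.m_inv_closed[OF K] k by simp
  then show ?thesis using c by (simp add: inv_solve_right' inv_solve_left')
qed

lemma exists_equivariant_transversal:
  assumes H: "subgroup H G" and K: "subgroup K G"
  obtains t where "t \<in> (\<Pi> c\<in>rcosets H. c)"
    and "\<And>c k. \<lbrakk>c \<in> rcosets H; k \<in> K; \<forall>l\<in>K. c #> l = c \<longrightarrow> l = \<one>\<rbrakk> \<Longrightarrow> t (c #> k) = t c \<otimes> k"
proof -
  obtain base offset where base: "\<And>c. c \<in> rcosets H \<Longrightarrow> base c \<in> rcosets H"
    and offset: "\<And>c. c \<in> rcosets H \<Longrightarrow> offset c \<in> K \<and> base c #> offset c = c"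
    and base_shift: "\<And>c k. c \<in> rcosets H \<Longrightarrow> k \<in> K \<Longrightarrow> base (c #> k) = base c"
    using exists_rcosets_orbit_base[OF H K] by blast
  define t where "t c = (SOME x. x \<in> base c) \<otimes> offset c" for c
  have coset_carrier: "c \<subseteq> carrier G" if "c \<in> rcosets H" for c
    by (rule subgroup.rcosets_carrier[OF H is_group that])
  have some_base: "(SOME x. x \<in> base c) \<in> base c" if "c \<in> rcosets H" for c
    using subgroup.rcosets_non_empty[OF H base[OF that]] by (simp add: some_in_eq)
  have "t \<in> (\<Pi> c\<in>rcosets H. c)"
  proof
    fix c assume c: "c \<in> rcosets H"
    have "t c \<in> base c #> offset c" using some_base[OF c] by (auto simp: t_def r_coset_def)
    then show "t c \<in> c" using offset[OF c] by simp
  qed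
  moreover have "t (c #> k) = t c \<otimes> k"
    if c: "c \<in> rcosets H" and k: "k \<in> K" and free: "\<forall>l\<in>K. c #> l = c \<longrightarrow> l = \<one>" for c k
  proof -
    have K_carrier: "k \<in> carrier G" "offset c \<in> carrier G"
      using k offset[OF c] subgroup.mem_carrier[OF K] by auto
    have ck_coset: "c #> k \<in> rcosets H" using subgroup.subset[OF H] c K_carrier(1)
      by (rule r_coset_closed)
    have "offset (c #> k) = offset c \<otimes> k"
      by (rule r_coset_free_shift_eq[OF coset_carrier[OF base[OF c]] K])
        (use k free offset[OF c] offset[OF ck_coset] base_shift[OF c k] in auto)
    then show ?thesis
      using some_base[OF c] coset_carrier[OF base[OF c]] K_carrier
      by (auto simp: t_def base_shift[OF c k] m_assoc subset_iff)
  qed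
  ultimately show ?thesis by (rule that)
qed

end

context finite_group
begin

lemma prime_order_subgroup_r_coset_fixed_iff:
  assumes "subgroup H G" "subgroup K G" "prime (card K)" "x \<in> K" "x \<noteq> \<one>" "c \<in> rcosets H"
  shows "c #> x = c \<longleftrightarrow> (\<forall>k\<in>K. c #> k = c)"
proof
  have H_carrier: "H \<subseteq> carrier G" and K_carrier: "K \<subseteq> carrier G" using assms(1,2) subgroup.subset
    by auto
  obtain a where a: "a \<in> carrier G" "c = H #> a" using assms(6) by (auto simp: RCOSETS_def)
  assume "c #> x = c"
  then have "conj_set G a {x} \<subseteq> H"
    using r_coset_fixed_iff[OF assms(1), of "{x}" a] assms(4) K_carrier a by auto
  then have "x \<in> conj_set G (inv a) H"
    using conj_set_subset_iff[of "{x}" H a] assms(4) H_carrier K_carrier a(1) by auto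
  then have "K \<subseteq> conj_set G (inv a) H"
    using prime_order_subgroup_subset[OF assms(2,3) _ assms(4) _ assms(5)] assms(1) a(1)
    by (simp add: subgroup_conj_set)
  then have "conj_set G a K \<subseteq> H" using conj_set_subset_iff[OF K_carrier H_carrier a(1)] by simp
  then show "\<forall>k\<in>K. c #> k = c" using r_coset_fixed_iff[OF assms(1) K_carrier a(1)] a(2) by simp
qed (use assms(4) in blast)

lemma abelian_sylow_fusion:
  assumes p: "prime p" and P: "P \<in> sylow_subgroups G p"
    and abelian: "P \<subseteq> centralizer G P" and norm: "normalizer G P \<subseteq> centralizer G P"
    and x: "x \<in> P" and g: "g \<in> carrier G" and conj: "g \<otimes> x \<otimes> inv g \<in> P"
  shows "g \<otimes> x \<otimes> inv g = x"
proof -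
  \<comment> \<open>Both P and its conjugate by g are Sylow subgroups of the centralizer of the conjugate of x.\<close>
  let ?y = "g \<otimes> x \<otimes> inv g" and ?C = "centralizer G {g \<otimes> x \<otimes> inv g}"
  note P_carrier = sylow_subgroupsD(3)[OF P]
  have x_carrier: "x \<in> carrier G" using x P_carrier by auto
  have C: "subgroup ?C G" by (rule subgroup_centralizer) (use x_carrier g in auto)
  have commute: "u \<otimes> v = v \<otimes> u" if "u \<in> P" "v \<in> P" for u v
    using abelian that by (auto simp: centralizer_def)
  have "P \<subseteq> ?C" using commute conj P_carrier by (auto simp: centralizer_def)
  moreover have "conj_set G g P \<subseteq> ?C"
  proof -
    have "g \<otimes> h \<otimes> inv g \<otimes> ?y = ?y \<otimes> (g \<otimes> h \<otimes> inv g)" if "h \<in> P" for h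
      using that P_carrier commute[OF that x] g x_carrier by (auto simp: conj_mult_distrib subset_iff)
    then show ?thesis using P_carrier g by (auto simp: conj_set_def centralizer_def)
  qed
  ultimately obtain c where c: "c \<in> ?C" "P = conj_set G c (conj_set G g P)"
    using sylow_conj_in[OF p C] sylow_subgroups_restrictI[OF p _ C] P conj_set_sylow[OF P g] by metis
  then have c_facts: "c \<in> carrier G" "c \<otimes> ?y = ?y \<otimes> c" by (auto simp: centralizer_def)
  have "c \<otimes> g \<in> normalizer G P"
    using c(2) c_facts(1) g P_carrier by (simp add: mem_normalizer conj_set_mult)
  then have "c \<otimes> g \<otimes> x = x \<otimes> (c \<otimes> g)" using norm x by (auto simp: centralizer_def)
  then have "x = c \<otimes> g \<otimes> x \<otimes> inv (c \<otimes> g)" using conj_eq_self_iff[of "c \<otimes> g" x] c_facts(1) g x_carrier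
    by simp
  also have "\<dots> = c \<otimes> ?y \<otimes> inv c" using c_facts(1) g x_carrier by (simp add: m_assoc inv_mult_group)
  also have "\<dots> = ?y" using conj_eq_self_iff[of c ?y] c_facts g x_carrier by simp
  finally show ?thesis by simp
qed

lemma nat_pow_card_subgroup:
  assumes "subgroup K G" "x \<in> K"
  shows "x [^] card K = \<one>"
proof -
  interpret K: finite_group "G\<lparr>carrier := K\<rparr>" by (rule finite_group_restrict[OF assms(1)])
  show ?thesis using K.pow_order_eq_1[of x] assms by (simp add: order_def flip: nat_pow_consistent)
qed

text \<open>
  Choosing the transversal equivariant on the free orbits of a subgroup of prime order, only the fixed
  cosets contribute to the transfer of an element of that subgroup.
\<close>

lemma transfer_prime_order:
  assumes p: "prime p" and P: "P \<in> sylow_subgroups G p"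
    and abelian: "P \<subseteq> centralizer G P" and norm: "normalizer G P \<subseteq> centralizer G P"
    and K: "subgroup K G" "K \<subseteq> P" "card K = p" and x: "x \<in> K" "x \<noteq> \<one>"
  obtains t where "t \<in> (\<Pi> c\<in>rcosets P. c)"
    and "transfer G P t x = x [^] card {c \<in> rcosets P. c #> x = c}"
proof -
  let ?P = "G\<lparr>carrier := P\<rparr>" and ?F = "{c \<in> rcosets P. c #> x = c}"
  note P_sylow = sylow_subgroupsD(1,3)[OF P]
  interpret P: comm_group ?P by (rule comm_group_restrict[OF P_sylow(1) abelian])
  have x_mem: "x \<in> P" and x_carrier: "x \<in> carrier G" using x K(2) P_sylow(2) by auto
  obtain t where t: "t \<in> (\<Pi> c\<in>rcosets P. c)"
    and equivariant: "\<And>c k. \<lbrakk>c \<in> rcosets P; k \<in> K; \<forall>l\<in>K. c #> l = c \<longrightarrow> l = \<one>\<rbrakk> \<Longrightarrow> t (c #> k) = t c \<otimes> k"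
    using exists_equivariant_transversal[OF P_sylow(1) K(1)] by blast
  have t_carrier: "t c \<in> carrier G" if "c \<in> rcosets P" for c
    using Pi_mem[OF t that] subgroup.rcosets_carrier[OF P_sylow(1) is_group that] by auto
  have fixed: "t c \<otimes> x \<otimes> inv (t (c #> x)) = x" if "c \<in> rcosets P" "c #> x = c" for c
    using abelian_sylow_fusion[OF p P abelian norm x_mem t_carrier[OF that(1)]]
      transfer_factor_closed[OF P_sylow(1) t that(1) x_carrier] that(2) by simp
  have free: "t c \<otimes> x \<otimes> inv (t (c #> x)) = \<one>" if c: "c \<in> rcosets P" "c #> x \<noteq> c" for c
  proof -
    have "\<forall>l\<in>K. c #> l = c \<longrightarrow> l = \<one>"
      using prime_order_subgroup_r_coset_fixed_iff[OF P_sylow(1) K(1) _ _ _ c(1)] c(2) x p K(3) by metis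
    then show ?thesis using equivariant[OF c(1) x(1)] t_carrier[OF c(1)] x_carrier by simp
  qed
  have "transfer G P t x = finprod ?P (\<lambda>c. x) ?F"
    unfolding transfer_def
    using fixed free x_mem P_sylow(1) transfer_factor_closed[OF P_sylow(1) t _ x_carrier]
    by (intro P.finprod_mono_neutral_cong_right) auto
  also have "\<dots> = x [^] card ?F" using P.finprod_const[of x ?F] x_mem by (simp flip: nat_pow_consistent)
  finally show ?thesis using that t by blast
qed

lemma burnside_transfer_nontrivial:
  assumes p: "prime p" "p dvd order G" and P: "P \<in> sylow_subgroups G p"
    and abelian: "P \<subseteq> centralizer G P" and norm: "normalizer G P \<subseteq> centralizer G P"
  obtains V x where "V \<in> hom G (G\<lparr>carrier := P\<rparr>)" "x \<in> P" "V x \<noteq> \<one>"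
proof -
  note P_sylow = sylow_subgroupsD[OF P]
  have "p ^ 1 dvd card P" using p P_sylow(2) by (simp add: prime_multiplicity_gt_zero_iff)
  then obtain K where K: "subgroup K G" "K \<subseteq> P" "card K = p"
    using exists_prime_power_subgroup_subset[OF p(1) P_sylow(1), of 1] by auto
  have "K \<noteq> {\<one>}" using K(3) p(1) by auto
  then obtain x where x: "x \<in> K" "x \<noteq> \<one>" using subgroup.one_closed[OF K(1)] by auto
  have x_mem: "x \<in> P" and x_carrier: "x \<in> carrier G" using x K(2) P_sylow(3) by auto
  let ?F = "{c \<in> rcosets P. c #> x = c}"
  obtain t where t: "t \<in> (\<Pi> c\<in>rcosets P. c)" "transfer G P t x = x [^] card ?F"
    using transfer_prime_order[OF p(1) P abelian norm K x] .
  have "?F = {c \<in> rcosets P. \<forall>k\<in>K. c #> k = c}"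
    using prime_order_subgroup_r_coset_fixed_iff[OF P_sylow(1) K(1) _ x] p(1) K(3) by auto
  then have "[card (rcosets P) = card ?F] (mod p)"
    using p_subgroup_rcosets_cong[OF p(1) P_sylow(1) K(1), of 1] K(3) by simp
  then have "\<not> p dvd card ?F" using not_dvd_sylow_index[OF p(1) P] cong_dvd_iff by blast
  moreover have "ord x = p"
  proof -
    have "ord x dvd p" using nat_pow_card_subgroup[OF K(1) x(1)] K(3) pow_eq_id[OF x_carrier] by simp
    then show ?thesis using p(1) x(2) ord_eq_1[OF x_carrier] by (auto simp: prime_nat_iff)
  qed
  ultimately have "transfer G P t x \<noteq> \<one>" using t(2) pow_eq_id[OF x_carrier] by simp
  then show ?thesis using that transfer_hom[OF P_sylow(1) abelian t(1)] x_mem by blast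
qed

end

section \<open>Simple groups\<close>

lemma (in simple_group) hom_inj_on_if_nontrivial:
  assumes "group_hom G H h" "x \<in> carrier G" "h x \<noteq> \<one>\<^bsub>H\<^esub>"
  shows "inj_on h (carrier G)"
proof -
  interpret h: group_hom G H h by (rule assms(1))
  have "x \<notin> kernel G H h" using assms(3) by (simp add: kernel_def)
  then show ?thesis
    using no_real_normal_subgroup[OF h.normal_kernel] assms(2) h.trivial_ker_imp_inj by blast
qed

lemma (in simple_group) normalizer_proper:
  assumes "subgroup H G" "H \<noteq> {\<one>}" "H \<noteq> carrier G"
  shows "normalizer G H \<noteq> carrier G"
  using assms no_real_normal_subgroup normal_iff_normalizer by blast

lemma BijGroup_embeds_sym_group:
  assumes "finite E"
  obtains \<psi> where "\<psi> \<in> hom (BijGroup E) (sym_group (card E))" "inj_on \<psi> (carrier (BijGroup E))"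
proof -
  let ?I = "{1..card E}"
  obtain b where b: "bij_betw b ?I E" using ex_bij_betw_nat_finite_1[OF assms] by blast
  let ?b' = "inv_into ?I b"
  have b_mem: "b i \<in> E" if "i \<in> ?I" for i using b that by (auto simp: bij_betw_def)
  have b'_mem: "?b' e \<in> ?I" and b_b': "b (?b' e) = e" if "e \<in> E" for e
    using b that by (metis bij_betw_def inv_into_into, metis bij_betw_inv_into_right)
  have b'_b: "?b' (b i) = i" if "i \<in> ?I" for i using b that by (metis bij_betw_inv_into_left)
  define \<psi> where "\<psi> f i = (if i \<in> ?I then ?b' (f (b i)) else i)" for f i
  have f_mem: "f e \<in> E" if "f \<in> Bij E" "e \<in> E" for f e using that by (auto simp: Bij_def bij_betw_def)
  have permutes: "\<psi> f permutes ?I" if f: "f \<in> Bij E" for f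
  proof (rule bij_imp_permutes)
    have "bij_betw (?b' \<circ> f \<circ> b) ?I ?I"
      using b f bij_betw_inv_into[OF b] by (auto simp: Bij_def intro: bij_betw_trans)
    then show "bij_betw (\<psi> f) ?I ?I"
      by (rule bij_betw_cong[THEN iffD1, rotated]) (simp add: \<psi>_def)
  qed (auto simp: \<psi>_def)
  have "\<psi> \<in> hom (BijGroup E) (sym_group (card E))"
  proof (rule homI)
    fix f g assume "f \<in> carrier (BijGroup E)" "g \<in> carrier (BijGroup E)"
    then show "\<psi> (f \<otimes>\<^bsub>BijGroup E\<^esub> g) = \<psi> f \<otimes>\<^bsub>sym_group (card E)\<^esub> \<psi> g"
      using b_mem b'_mem b_b' f_mem
      by (auto simp: BijGroup_def sym_group_mult \<psi>_def compose_def fun_eq_iff simp del: atLeastAtMost_iff)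
  qed (use permutes in \<open>simp add: BijGroup_def sym_group_carrier\<close>)
  moreover have "inj_on \<psi> (carrier (BijGroup E))"
  proof (rule inj_onI)
    fix f g assume fg_mem: "f \<in> carrier (BijGroup E)" "g \<in> carrier (BijGroup E)" and eq: "\<psi> f = \<psi> g"
    have "f e = g e" if "e \<in> E" for e
    proof -
      have "?b' (f e) = ?b' (g e)" using fun_cong[OF eq, of "?b' e"] b'_mem[OF that] b_b'[OF that]
        by (simp add: \<psi>_def)
      then show ?thesis using b_b' f_mem[OF _ that] fg_mem
        by (metis BijGroup_def partial_object.select_convs(1))
    qed
    then show "f = g" using fg_mem by (intro extensionalityI[of _ E]) (auto simp: BijGroup_def Bij_def)
  qed
  ultimately show ?thesis by (rule that)
qed

locale nonabelian_simple_group = finite_group + simple_group +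
  assumes nonabelian: "\<exists>x\<in>carrier G. \<exists>y\<in>carrier G. x \<otimes> y \<noteq> y \<otimes> x"
begin

lemma not_carrier_subset_centralizer: "\<not> carrier G \<subseteq> centralizer G (carrier G)"
  using nonabelian by (auto simp: centralizer_def)

lemma centralizer_proper:
  assumes "subgroup H G" "H \<noteq> {\<one>}"
  shows "centralizer G H \<noteq> carrier G"
proof
  assume eq: "centralizer G H = carrier G"
  have H_carrier: "H \<subseteq> carrier G" by (rule subgroup.subset[OF assms(1)])
  then have "normalizer G H = carrier G"
    using centralizer_subset_normalizer[OF H_carrier] eq mem_normalizer[OF H_carrier] by blast
  then have "H = carrier G" using normalizer_proper assms by blast
  then show False using eq not_carrier_subset_centralizer by simp
qed

lemma abelian_sylow_normalizer_not_subset_centralizer: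
  assumes "prime p" "p dvd order G" "P \<in> sylow_subgroups G p" "P \<subseteq> centralizer G P"
  shows "\<not> normalizer G P \<subseteq> centralizer G P"
proof
  note P = sylow_subgroupsD[OF assms(3)]
  assume "normalizer G P \<subseteq> centralizer G P"
  then obtain V x where V: "V \<in> hom G (G\<lparr>carrier := P\<rparr>)" and x: "x \<in> P" "V x \<noteq> \<one>"
    using burnside_transfer_nontrivial[OF assms] by blast
  interpret V: group_hom G "G\<lparr>carrier := P\<rparr>" V
    using V P(1) by (simp add: group_hom_def group_hom_axioms_def subgroup_imp_group)
  have inj: "inj_on V (carrier G)"
    by (rule hom_inj_on_if_nontrivial[OF V.group_hom_axioms]) (use x P(3) in auto)
  have "y \<otimes> z = z \<otimes> y" if "y \<in> carrier G" "z \<in> carrier G" for y z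
  proof -
    have "V y \<otimes> V z = V z \<otimes> V y"
      using V.hom_closed[OF that(1)] V.hom_closed[OF that(2)] assms(4) by (auto simp: centralizer_def)
    then have "V (y \<otimes> z) = V (z \<otimes> y)" using that by simp
    then show ?thesis using inj that by (auto simp: inj_on_def)
  qed
  then show False using nonabelian by auto
qed

lemma abelian_sylow_normalizer_prime:
  assumes "prime p" "p dvd order G" "P \<in> sylow_subgroups G p" "P \<subseteq> centralizer G P"
  obtains q j where "prime q" "q \<noteq> p" "q dvd card (normalizer G P)"
    and "1 \<le> j" "j \<le> multiplicity p (order G)" "q dvd p ^ j - 1"
proof (rule ccontr)
  assume none: "\<not> thesis"
  note P = sylow_subgroupsD[OF assms(3)]
  have N: "subgroup (normalizer G P) G" and C: "subgroup (centralizer G P) G"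
    using P(3) by (rule normalizer_imp_subgroup, rule subgroup_centralizer)
  let ?N = "G\<lparr>carrier := normalizer G P\<rparr>"
  interpret N: finite_group ?N by (rule finite_group_restrict[OF N])
  have "normalizer G P \<subseteq> centralizer G P"
  proof (rule subgroup_subset_if_sylow_subgroups_subset[OF N C])
    fix q :: nat assume q: "prime q" "q dvd card (normalizer G P)"
    show "\<exists>T\<in>sylow_subgroups ?N q. T \<subseteq> centralizer G P"
    proof (cases "q = p")
      case True
      then show ?thesis
        using sylow_subgroups_restrictI[OF assms(1,3) N subgroup_subset_normalizer[OF P(1)]] assms(4)
        by blast
    next
      case False
      obtain T where T: "T \<in> sylow_subgroups ?N q" using N.exists_sylow_subgroup[OF q(1)] .
      then have T_facts: "subgroup T G" "T \<subseteq> normalizer G P"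
        using sylow_subgroupsD(1) subgroup_restrict_iff[OF N] by blast+
      have "T \<subseteq> centralizer G P"
        using p_subgroup_centralizes_or_dvd[OF q(1) T_facts(1) sylow_subgroupsD(2)[OF T] assms(1) _
            P(1,2) T_facts(2)]
          False none that q by (metis atLeastAtMost_iff)
      then show ?thesis using T by blast
    qed
  qed
  then show False using abelian_sylow_normalizer_not_subset_centralizer[OF assms] by blast
qed

lemma embeds_sym_group_index:
  assumes "subgroup H G" "H \<noteq> carrier G"
  obtains \<phi> where "\<phi> \<in> hom G (sym_group (card (rcosets H)))" "inj_on \<phi> (carrier G)"
proof -
  let ?\<alpha> = "\<lambda>g. \<lambda>c\<in>rcosets H. c #> inv g"
  have H_carrier: "H \<subseteq> carrier G" by (rule subgroup.subset[OF assms(1)])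
  interpret group_action G "rcosets H" ?\<alpha> by (rule action_on_rcosets[OF H_carrier])
  interpret \<alpha>: group_hom G "BijGroup (rcosets H)" ?\<alpha> by (rule group_hom)
  obtain g where g: "g \<in> carrier G" "g \<notin> H" using assms(2) H_carrier by blast
  have H_coset: "H \<in> rcosets H" by (rule subgroup.subgroup_in_rcosets[OF assms(1) is_group])
  have "?\<alpha> (inv g) \<noteq> \<one>\<^bsub>BijGroup (rcosets H)\<^esub>"
  proof
    assume trivial: "?\<alpha> (inv g) = \<one>\<^bsub>BijGroup (rcosets H)\<^esub>"
    have "?\<alpha> (inv g) H = H" unfolding trivial using H_coset by (simp add: BijGroup_def)
    then show False using coset_join1[OF _ g(1) assms(1)] g H_coset by simp
  qed
  then have inj: "inj_on ?\<alpha> (carrier G)"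
    using hom_inj_on_if_nontrivial[OF \<alpha>.group_hom_axioms] inv_closed[OF g(1)] by blast
  obtain \<psi> where \<psi>: "\<psi> \<in> hom (BijGroup (rcosets H)) (sym_group (card (rcosets H)))"
      "inj_on \<psi> (carrier (BijGroup (rcosets H)))"
    using BijGroup_embeds_sym_group[OF finite_rcosets[OF assms(1)]] .
  have "\<psi> \<circ> ?\<alpha> \<in> hom G (sym_group (card (rcosets H)))" using Group.hom_compose[OF \<alpha>.homh \<psi>(1)] .
  moreover have "inj_on (\<psi> \<circ> ?\<alpha>) (carrier G)"
    using inj \<psi>(2) \<alpha>.hom_closed by (intro comp_inj_on inj_on_subset[OF \<psi>(2)]) auto
  ultimately show ?thesis by (rule that)
qed

lemma order_le_fact_index:
  assumes "subgroup H G" "H \<noteq> carrier G"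
  shows "order G \<le> fact (card (rcosets H))"
proof -
  obtain \<phi> where "\<phi> \<in> hom G (sym_group (card (rcosets H)))" "inj_on \<phi> (carrier G)"
    using embeds_sym_group_index[OF assms] .
  then have "card (carrier G) \<le> card (carrier (sym_group (card (rcosets H))))"
    by (intro card_inj_on_le[of \<phi>]) (auto simp: hom_def sym_group_def finite_permutations)
  then show ?thesis by (simp add: order_def sym_group_card_carrier)
qed

lemma iso_alt_group:
  assumes \<phi>: "\<phi> \<in> hom G (sym_group n)" "inj_on \<phi> (carrier G)" and ord: "2 * order G = fact n"
  shows "G \<cong> alt_group n"
proof -
  interpret \<phi>: group_hom G "sym_group n" \<phi>
    using \<phi>(1) by (simp add: group_hom_def group_hom_axioms_def sym_group_is_group)
  have sign: "group_hom G sign_img (sign \<circ> \<phi>)"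
    using Group.hom_compose[OF \<phi>(1) sign_is_hom]
    by (simp add: group_hom_def group_hom_axioms_def sign_img_is_group is_group)
  have "\<not> inj_on (sign \<circ> \<phi>) (carrier G)"
  proof
    assume inj: "inj_on (sign \<circ> \<phi>) (carrier G)"
    interpret \<sigma>: group_hom G sign_img "sign \<circ> \<phi>" by (rule sign)
    obtain x y where xy: "x \<in> carrier G" "y \<in> carrier G" "x \<otimes> y \<noteq> y \<otimes> x" using nonabelian by blast
    have "(sign \<circ> \<phi>) (x \<otimes> y) = (sign \<circ> \<phi>) (y \<otimes> x)"
      using \<sigma>.hom_mult[OF xy(1,2)] \<sigma>.hom_mult[OF xy(2,1)] by (simp add: sign_img_def mult.commute)
    then show False using inj_onD[OF inj] xy by simp
  qed
  then have "(sign \<circ> \<phi>) x = \<one>\<^bsub>sign_img\<^esub>" if "x \<in> carrier G" for x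
    using hom_inj_on_if_nontrivial[OF sign that] by blast
  then have sub: "\<phi> ` carrier G \<subseteq> carrier (alt_group n)"
    using \<phi>.hom_closed unfolding alt_group_is_sign_kernel kernel_def by auto
  have "n \<ge> 2" using ord order_pos by (cases "n \<le> 1") (auto simp: le_Suc_eq)
  then have "card (\<phi> ` carrier G) = card (carrier (alt_group n))"
    using alt_group_card_carrier[of n] card_image[OF \<phi>(2)] ord by (simp add: order_def)
  then have "\<phi> ` carrier G = carrier (alt_group n)"
    using sub
    by (intro card_subset_eq) (auto simp: alt_group_def intro: finite_subset[OF _ finite_permutations])
  moreover have "\<phi> \<in> hom G (alt_group n)"
    by (rule homI) (use sub \<phi>.hom_mult in \<open>auto simp: alt_group_mult sym_group_mult\<close>)
  ultimately show ?thesis using \<phi>(2) by (intro is_isoI) (auto simp: iso_def bij_betw_def)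
qed

end

section \<open>Groups of order \<open>r\<^sup>a q\<close>\<close>

lemma multiplicity_prime_power_times:
  fixes p m :: nat
  assumes "prime p" "\<not> p dvd m"
  shows "multiplicity p (p ^ a * m) = a"
  by (rule multiplicity_eqI) (use assms prime_gt_0_nat[OF assms(1)] in \<open>auto simp: mult.commute[of p]\<close>)

context finite_group
begin

lemma set_mult_eq_carrier:
  assumes A: "subgroup A G" and B: "subgroup B G" and "A \<inter> B = {\<one>}" "card A * card B = order G"
  shows "A <#> B = carrier G"
proof -
  interpret group_disjoint_sum G A B
    using A B by (simp add: group_disjoint_sum_def is_group)
  have eq: "A <#> B = (\<lambda>(a, b). a \<otimes> b) ` (A \<times> B)" by (force simp: set_mult_def)
  have "inj_on (\<lambda>(a, b). a \<otimes> b) (A \<times> B)" using cancel assms(3) by (auto simp: inj_on_def)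
  then have "card (A <#> B) = card (carrier G)"
    using assms(4) unfolding eq by (simp add: card_image card_cartesian_product order_def)
  then show ?thesis
    using setmult_subset_G[OF subgroup.subset[OF A] subgroup.subset[OF B]]
    by (intro card_subset_eq) auto
qed

lemma subset_Inter_sylow_subgroups:
  assumes "prime p" "P \<in> sylow_subgroups G p" "subgroup Q G" "Q <#> P = carrier G"
    and D: "D \<subseteq> P" "Q \<subseteq> normalizer G D"
  shows "D \<subseteq> \<Inter>(sylow_subgroups G p)"
proof (rule Inter_greatest)
  note P = sylow_subgroupsD[OF assms(2)]
  fix S assume "S \<in> sylow_subgroups G p"
  then obtain g where g: "g \<in> carrier G" "S = conj_set G g P" using sylow_conj[OF assms(1,2)] by blast
  then have "g \<in> Q <#> P" using assms(4) by simp
  then obtain x y where xy: "x \<in> Q" "y \<in> P" "g = x \<otimes> y" by (auto simp: set_mult_def)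
  then have "S = conj_set G x P"
    using g(2) conj_set_mult[of P x y] conj_set_self[OF P(1)] P(3) subgroup.mem_carrier[OF assms(3)]
    by auto
  moreover have "conj_set G x D = D" using xy(1) D P(3) mem_normalizer[of D] by auto
  ultimately show "D \<subseteq> S" using conj_set_mono[OF D(1), of x] by simp
qed

lemma card_Union_trivially_intersecting:
  assumes "finite S" and S: "\<And>H. H \<in> S \<Longrightarrow> subgroup H G \<and> card H = n"
    and "\<And>H K. H \<in> S \<Longrightarrow> K \<in> S \<Longrightarrow> H \<noteq> K \<Longrightarrow> H \<inter> K = {\<one>}"
  shows "card (\<Union>S - {\<one>}) = card S * (n - 1)"
proof -
  have "\<Union>S - {\<one>} = (\<Union>H\<in>S. H - {\<one>})" by blast
  also have "card \<dots> = (\<Sum>H\<in>S. card (H - {\<one>}))"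
    using assms by (intro card_UN_disjoint) auto
  also have "\<dots> = (\<Sum>H\<in>S. n - 1)"
    by (rule sum.cong) (use S subgroup.one_closed card_Diff_singleton in metis)+
  finally show ?thesis by simp
qed

lemma card_sylow_subgroup_eq:
  assumes "prime p" "\<not> p dvd m" "order G = p ^ a * m" "P \<in> sylow_subgroups G p"
  shows "card P = p ^ a"
  using sylow_subgroupsD(2)[OF assms(4)] multiplicity_prime_power_times[OF assms(1,2)] assms(3) by simp

lemma sylow_subgroups_inter_trivial:
  assumes r: "prime r" and q: "prime q" and "r \<noteq> q" and ord: "order G = r ^ a * q"
    and core: "\<Inter>(sylow_subgroups G r) = {\<one>}"
    and PR: "P \<in> sylow_subgroups G r" "R \<in> sylow_subgroups G r" "P \<noteq> R"
  shows "P \<inter> R = {\<one>}"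
proof (rule ccontr)
  assume nontriv: "P \<inter> R \<noteq> {\<one>}"
  obtain A B where AB: "A \<in> sylow_subgroups G r" "B \<in> sylow_subgroups G r" "A \<noteq> B"
    and max: "\<And>C D. C \<in> sylow_subgroups G r \<Longrightarrow> D \<in> sylow_subgroups G r \<Longrightarrow> C \<noteq> D \<Longrightarrow>
      card (C \<inter> D) \<le> card (A \<inter> B)"
    using exists_maximal_sylow_inter[OF PR] by metis
  note A = sylow_subgroupsD[OF AB(1)]
  let ?D = "A \<inter> B"
  have D: "subgroup ?D G" and PR_subgroup: "subgroup (P \<inter> R) G"
    using subgroups_Inter_pair sylow_subgroupsD(1) AB PR by blast+
  have N: "subgroup (normalizer G ?D) G" by (rule normalizer_imp_subgroup[OF subgroup.subset[OF D]])
  have "\<not> card (normalizer G ?D) dvd r ^ a"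
    using normalizer_maximal_sylow_inter[OF r AB max] r by (auto simp: divides_primepow_nat)
  then have "q dvd card (normalizer G ?D)"
    using card_subgroup_dvd_order[OF N] ord prime_imp_coprime[OF q]
    by (metis coprime_commute coprime_dvd_mult_left_iff)
  then obtain Q where Q: "subgroup Q G" "Q \<subseteq> normalizer G ?D" "card Q = q"
    using exists_prime_power_subgroup_subset[OF q N, of 1] by auto
  have "\<not> r dvd q" using r q \<open>r \<noteq> q\<close> primes_dvd_imp_eq by blast
  then have card_A: "card A = r ^ a" using card_sylow_subgroup_eq[OF r _ ord AB(1)] by blast
  have "coprime q (r ^ a)" using r q \<open>r \<noteq> q\<close> by (simp add: primes_coprime)
  then have "Q \<inter> A = {\<one>}" using coprime_subgroups_inter[OF Q(1) A(1)] Q(3) card_A by simp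
  then have "Q <#> A = carrier G"
    using set_mult_eq_carrier[OF Q(1) A(1)] Q(3) card_A ord by (simp add: mult.commute)
  then have "?D \<subseteq> {\<one>}" using subset_Inter_sylow_subgroups[OF r AB(1) Q(1) _ _ Q(2)] core by blast
  then have "card (P \<inter> R) \<le> 1" using max[OF PR] card_mono[of "{\<one>}" ?D] by simp
  then show False
    using nontriv card_one_subgroup_iff[OF PR_subgroup] card_subgroup_pos[OF PR_subgroup] by linarith
qed

lemma card_outside_sylow_subgroups:
  assumes r: "prime r" and q: "prime q" and "r \<noteq> q" and ord: "order G = r ^ a * q"
    and core: "\<Inter>(sylow_subgroups G r) = {\<one>}" and number: "card (sylow_subgroups G r) = q"
  shows "card (carrier G - (\<Union>(sylow_subgroups G r) - {\<one>})) = q"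
proof -
  let ?S = "sylow_subgroups G r" and ?U = "\<Union>(sylow_subgroups G r) - {\<one>}"
  have "\<not> r dvd q" using r q \<open>r \<noteq> q\<close> primes_dvd_imp_eq by blast
  have "card ?U = card ?S * (r ^ a - 1)"
  proof (rule card_Union_trivially_intersecting)
    show "subgroup R G \<and> card R = r ^ a" if "R \<in> ?S" for R
      using sylow_subgroupsD(1)[OF that] card_sylow_subgroup_eq[OF r \<open>\<not> r dvd q\<close> ord that] by blast
  qed (use sylow_subgroups_inter_trivial[OF r q \<open>r \<noteq> q\<close> ord core] in auto)
  moreover have U: "?U \<subseteq> carrier G" using sylow_subgroupsD(3) by fastforce
  ultimately have "card (carrier G - ?U) = r ^ a * q - q * (r ^ a - 1)"
    using card_Diff_subset[OF finite_subset_carrier[OF U] U] number ord by (simp add: order_def)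
  also have "\<dots> = q" using prime_gt_0_nat[OF r] by (simp add: right_diff_distrib' mult.commute)
  finally show ?thesis .
qed

lemma normalizer_sylow_order_prime_power_times_prime:
  assumes r: "prime r" and q: "prime q" and "r \<noteq> q" and ord: "order G = r ^ a * q"
    and core: "\<Inter>(sylow_subgroups G r) = {\<one>}" and number: "card (sylow_subgroups G r) = q"
    and Q: "Q \<in> sylow_subgroups G q"
  shows "normalizer G Q = carrier G"
proof -
  let ?U = "\<Union>(sylow_subgroups G r) - {\<one>}"
  have not_dvd: "\<not> r dvd q" "\<not> q dvd r ^ a"
    using r q \<open>r \<noteq> q\<close> by (metis primes_dvd_imp_eq, metis prime_dvd_power primes_dvd_imp_eq)
  have "S = carrier G - ?U" if S: "S \<in> sylow_subgroups G q" for S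
  proof -
    have card: "card S = q"
      using card_sylow_subgroup_eq[OF q not_dvd(2) _ S, of 1] ord by (simp add: mult.commute)
    have "S \<inter> R = {\<one>}" if R: "R \<in> sylow_subgroups G r" for R
      using coprime_subgroups_inter[OF sylow_subgroupsD(1)[OF S] sylow_subgroupsD(1)[OF R]] card r q
        card_sylow_subgroup_eq[OF r not_dvd(1) ord R] \<open>r \<noteq> q\<close> by (simp add: primes_coprime)
    then have "S \<subseteq> carrier G - ?U" using sylow_subgroupsD(3)[OF S] by auto
    then show ?thesis
      using card card_outside_sylow_subgroups[OF r q \<open>r \<noteq> q\<close> ord core number]
      by (intro card_subset_eq) auto
  qed
  then have "sylow_subgroups G q = {Q}" using Q by blast
  then show ?thesis by (rule normalizer_unique_sylow_subgroup[OF q])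
qed

end

lemma (in simple_group) normalizer_of_prime_index:
  assumes fin: "finite (carrier G)" and H: "subgroup H G" "H \<noteq> {\<one>}" "prime (card (rcosets H))"
  shows "normalizer G H = H"
proof -
  interpret finite_group G by unfold_locales (rule fin)
  let ?N = "normalizer G H"
  have N: "subgroup ?N G" by (rule normalizer_imp_subgroup[OF subgroup.subset[OF H(1)]])
  have H_subset: "H \<subseteq> ?N" by (rule subgroup_subset_normalizer[OF H(1)])
  interpret N: finite_group "G\<lparr>carrier := ?N\<rparr>" by (rule finite_group_restrict[OF N])
  have "card (rcosets H) \<noteq> 1" using H(3) by auto
  then have "H \<noteq> carrier G" using card_rcosets_eq_1_iff[OF H(1)] by simp
  then have "card (rcosets ?N) \<noteq> 1"
    using normalizer_proper[OF H(1,2)] card_rcosets_eq_1_iff[OF N] by simp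
  then have "card (rcosets\<^bsub>G\<lparr>carrier := ?N\<rparr>\<^esub> H) = 1"
    using card_rcosets_mult[OF H(1) N H_subset] H(3) by (metis prime_product)
  then show ?thesis
    using N.card_rcosets_eq_1_iff[of H] H(1) H_subset N by (simp add: subgroup_restrict_iff)
qed

context nonabelian_simple_group
begin

lemma order_not_prime_power:
  assumes "prime p"
  shows "order G \<noteq> p ^ n"
proof
  assume ord: "order G = p ^ n"
  let ?Z = "carrier G \<inter> centralizer G (carrier G)"
  have "n > 0" using ord order_gt_one by (cases n) auto
  then have "p dvd card ?Z"
    using p_group_center_nontrivial[OF assms subgroup_self] ord by (simp add: order_def)
  then have "?Z \<noteq> {\<one>}" using assms by auto
  then have "centralizer G ?Z \<noteq> carrier G"
    by (intro centralizer_proper subgroup_inter_centralizer subgroup_self) auto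
  then show False by (auto simp: centralizer_def)
qed

lemma Inter_sylow_subgroups_trivial:
  assumes "prime p"
  shows "\<Inter>(sylow_subgroups G p) = {\<one>}"
proof -
  obtain P where P: "P \<in> sylow_subgroups G p" using exists_sylow_subgroup[OF assms] .
  have "P \<noteq> carrier G"
    using sylow_subgroupsD(2)[OF P] order_not_prime_power[OF assms] by (metis order_def)
  then have "\<Inter>(sylow_subgroups G p) \<noteq> carrier G" using P sylow_subgroupsD(3)[OF P] by blast
  then show ?thesis using no_real_normal_subgroup[OF normal_Inter_sylow_subgroups[OF assms]] by blast
qed

lemma order_not_prime_power_times_prime:
  assumes r: "prime r" and q: "prime q" and "r \<noteq> q"
  shows "order G \<noteq> r ^ a * q"
proof
  assume ord: "order G = r ^ a * q"
  obtain P where P: "P \<in> sylow_subgroups G r" using exists_sylow_subgroup[OF r] .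
  obtain Q where Q: "Q \<in> sylow_subgroups G q" using exists_sylow_subgroup[OF q] .
  note P_sylow = sylow_subgroupsD[OF P]
  have r_pos: "r > 0" by (rule prime_gt_0_nat[OF r])
  have not_dvd: "\<not> r dvd q" "\<not> q dvd r ^ a"
    using r q \<open>r \<noteq> q\<close> by (metis primes_dvd_imp_eq, metis prime_dvd_power primes_dvd_imp_eq)
  have card_P: "card P = r ^ a" by (rule card_sylow_subgroup_eq[OF r not_dvd(1) ord P])
  have "a \<noteq> 0" using ord order_not_prime_power[OF q, of 1] by (intro notI) simp
  then have "P \<noteq> {\<one>}" using p_subgroup_nontrivial[OF r P_sylow(1) card_P] by simp
  moreover have "card (rcosets P) = q" using lagrange[OF P_sylow(1)] card_P ord r_pos by simp
  ultimately have "normalizer G P = P" using normalizer_of_prime_index[OF fin P_sylow(1)] q by simp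
  then have "card (sylow_subgroups G r) = q"
    using card_sylow_subgroups[OF r P] card_P ord r_pos by simp
  then have "normalizer G Q = carrier G"
    using normalizer_sylow_order_prime_power_times_prime[OF r q \<open>r \<noteq> q\<close> ord _ _ Q]
      Inter_sylow_subgroups_trivial[OF r] by blast
  moreover have "card Q = q"
    using card_sylow_subgroup_eq[OF q not_dvd(2) _ Q, of 1] ord by (simp add: mult.commute)
  then have "Q \<noteq> {\<one>}" "Q \<noteq> carrier G"
    using q order_not_prime_power[OF q, of 1] by (auto simp: order_def)
  ultimately show False using normalizer_proper[OF sylow_subgroupsD(1)[OF Q]] by blast
qed

end

section \<open>Subgroups that are not self-normalizing\<close>

definition non_self_normalizing :: "('a, 'b) monoid_scheme \<Rightarrow> 'a set \<Rightarrow> bool" where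
  "non_self_normalizing G H \<longleftrightarrow> subgroup H G \<and> H \<noteq> {\<one>\<^bsub>G\<^esub>} \<and> normalizer G H \<noteq> H"

definition non_self_normalizing_orders :: "('a, 'b) monoid_scheme \<Rightarrow> nat set" where
  "non_self_normalizing_orders G = card ` {H. non_self_normalizing G H}"

definition small_prime_power_divisors :: "nat \<Rightarrow> (nat \<times> nat) set" where
  "small_prime_power_divisors n = {(p, k). prime p \<and> k \<in> {1, 2} \<and> p ^ k dvd n}"

lemma inj_on_power_small_prime_power_divisors:
  "inj_on (\<lambda>(p, k). p ^ k) (small_prime_power_divisors n)"
  by (auto simp: inj_on_def small_prime_power_divisors_def prime_power_inj'')

lemma multiplicity_eq_1_if_square_not_dvd:
  "p dvd n \<Longrightarrow> \<not> p ^ 2 dvd n \<Longrightarrow> multiplicity p n = 1"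
  by (intro multiplicity_eqI) (auto simp: numeral_2_eq_2)

lemma prime_factors_iff_small_prime_power_divisors:
  "0 < n \<Longrightarrow> p \<in> prime_factors n \<longleftrightarrow> (p, 1) \<in> small_prime_power_divisors n"
  by (auto simp: small_prime_power_divisors_def prime_factors_dvd)

lemma small_prime_power_divisors_cases:
  assumes card: "card (small_prime_power_divisors n) = 4" and "4 dvd n" "3 dvd n"
  obtains (square) "small_prime_power_divisors n = {(2, 1), (2, 2), (3, 1), (3, 2)}"
  | (prime) q where "prime q" "5 \<le> q" "small_prime_power_divisors n = {(2, 1), (2, 2), (3, 1), (q, 1)}"
proof -
  let ?E = "small_prime_power_divisors n"
  define A :: "(nat \<times> nat) set" where "A = {(2, 1), (2, 2), (3, 1)}"
  have sub: "A \<subseteq> ?E"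
    using assms(2,3) by (auto simp: A_def small_prime_power_divisors_def intro: dvd_trans[of 2 4])
  have "finite A" "card A = 3" by (simp_all add: A_def)
  then have "card (?E - A) = 1" using card sub by (simp add: card_Diff_subset)
  then obtain q k where "?E - A = {(q, k)}" by (metis card_1_singletonE surj_pair)
  then have E: "?E = insert (q, k) A" "(q, k) \<notin> A" using sub by blast+
  then have "(q, k) \<in> ?E" by simp
  then have q: "prime q" and k: "k \<in> {1, 2}" and dvd: "q ^ k dvd n"
    by (auto simp: small_prime_power_divisors_def)
  then have "q dvd n" by (auto dest: dvd_mult_left simp: power2_eq_square)
  then have "(q, 1) \<in> insert (q, k) A" unfolding E(1)[symmetric] using q
    by (simp add: small_prime_power_divisors_def)
  then have "q \<in> {2, 3} \<or> k = 1" by (auto simp: A_def)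
  then consider (nine) "(q, k) = (3, 2)" | (new_prime) "k = 1" "q \<noteq> 2" "q \<noteq> 3"
    using E(2) k by (auto simp: A_def)
  then show thesis
  proof cases
    case nine
    then show thesis using square E(1) by (simp add: A_def insert_commute)
  next
    case new_prime
    have "q \<noteq> 4" using q by auto
    then have "5 \<le> q" using prime_gt_1_nat[OF q] new_prime(2,3) by linarith
    then show thesis using prime[OF q] E(1) new_prime(1) by (simp add: A_def insert_commute)
  qed
qed

lemma four_times_three_power_or_twelve_times_prime:
  assumes "0 < n" "card (small_prime_power_divisors n) = 4" and mult2: "multiplicity 2 n = 2" and "3 dvd n"
  obtains (three_power) b where "n = 4 * 3 ^ b" "2 \<le> b" | (prime) q where "n = 12 * q" "prime q" "5 \<le> q"
proof -
  let ?E = "small_prime_power_divisors n"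
  have factorization: "n = (\<Prod>p\<in>prime_factors n. p ^ multiplicity p n)"
    by (rule prime_factorization_nat[OF assms(1)])
  note factors = prime_factors_iff_small_prime_power_divisors[OF assms(1)]
  have "4 dvd n" using multiplicity_dvd[of 2 n] mult2 by simp
  with assms(2) show ?thesis using assms(4)
  proof (cases rule: small_prime_power_divisors_cases)
    case square
    have "prime_factors n = {2, 3}" using factors unfolding square by auto
    then have "n = 4 * 3 ^ multiplicity 3 n" using factorization mult2 by simp
    moreover have "(3, 2) \<in> ?E" unfolding square by simp
    then have "2 \<le> multiplicity 3 n"
      using assms(1) by (intro multiplicity_geI) (auto simp: small_prime_power_divisors_def)
    ultimately show ?thesis by (rule three_power)
  next
    case (prime q)
    have "multiplicity p n = 1" if p: "p \<in> {3, q}" for p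
    proof -
      have "(p, 1) \<in> ?E" "(p, 2) \<notin> ?E" unfolding prime(3) using p prime(2) by auto
      then show ?thesis
        by (intro multiplicity_eq_1_if_square_not_dvd) (auto simp: small_prime_power_divisors_def)
    qed
    moreover have "prime_factors n = {2, 3, q}" using factors unfolding prime(3) by auto
    ultimately have "n = 12 * q" using factorization mult2 prime(2) by simp
    then show ?thesis using that(2) prime(1,2) by blast
  qed
qed

context finite_group
begin

lemma finite_non_self_normalizing: "finite {H. non_self_normalizing G H}"
  by (rule finite_subset[of _ "Pow (carrier G)"])
    (auto simp: non_self_normalizing_def dest: subgroup.subset)

lemma finite_non_self_normalizing_orders [simp]: "finite (non_self_normalizing_orders G)"
  by (simp add: non_self_normalizing_orders_def finite_non_self_normalizing)

lemma non_self_normalizing_ordersI: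
  "non_self_normalizing G H \<Longrightarrow> card H \<in> non_self_normalizing_orders G"
  by (auto simp: non_self_normalizing_orders_def)

lemma one_notin_non_self_normalizing_orders: "1 \<notin> non_self_normalizing_orders G"
proof
  assume "1 \<in> non_self_normalizing_orders G"
  then obtain H where "non_self_normalizing G H" "1 = card H"
    unfolding non_self_normalizing_orders_def by blast
  then show False using card_one_subgroup_iff[of H] by (simp add: non_self_normalizing_def)
qed

lemma subgroup_conj_class_eq: "subgroup_conj_class G H = (\<lambda>g. conj_set G g H) ` carrier G"
  by (auto simp: subgroup_conj_class_def conj_set_eq_cosets)

lemma subgroup_conj_class_self: "subgroup H G \<Longrightarrow> H \<in> subgroup_conj_class G H"
  unfolding subgroup_conj_class_eq by (intro image_eqI[of _ _ \<one>]) (auto simp: subgroup.subset)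

lemma card_image_subgroup_conj_class:
  assumes "subgroup H G"
  shows "card ` subgroup_conj_class G H = {card H}"
proof -
  have "card K = card H" if "K \<in> subgroup_conj_class G H" for K
    using that subgroup.subset[OF assms] by (auto simp: subgroup_conj_class_eq)
  then show ?thesis using subgroup_conj_class_self[OF assms] by blast
qed

lemma D_num_eq: "D_num G = card (subgroup_conj_class G ` {H. non_self_normalizing G H})"
  unfolding D_num_def non_self_normalizing_def by (rule arg_cong[of _ _ card]) auto

lemma card_non_self_normalizing_orders_eq:
  "card (non_self_normalizing_orders G) =
    card ((\<lambda>c. card ` c) ` subgroup_conj_class G ` {H. non_self_normalizing G H})"
proof -
  have "(\<lambda>c. card ` c) ` subgroup_conj_class G ` {H. non_self_normalizing G H} =
      (\<lambda>n. {n}) ` non_self_normalizing_orders G"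
    unfolding non_self_normalizing_orders_def image_image
    by (rule image_cong) (auto simp: non_self_normalizing_def card_image_subgroup_conj_class)
  then show ?thesis by (simp add: card_image)
qed

lemma card_non_self_normalizing_orders_le_D_num: "card (non_self_normalizing_orders G) \<le> D_num G"
  unfolding card_non_self_normalizing_orders_eq D_num_eq
  by (intro card_image_le finite_imageI finite_non_self_normalizing)

lemma non_self_normalizing_conj_if_card_eq:
  assumes eq: "card (non_self_normalizing_orders G) = D_num G"
    and H: "non_self_normalizing G H" and K: "non_self_normalizing G K" and "card H = card K"
  shows "\<exists>g\<in>carrier G. K = conj_set G g H"
proof -
  have "inj_on (\<lambda>c. card ` c) (subgroup_conj_class G ` {H. non_self_normalizing G H})"
    using eq unfolding card_non_self_normalizing_orders_eq D_num_eq
    by (intro eq_card_imp_inj_on finite_imageI finite_non_self_normalizing)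
  then have "subgroup_conj_class G H = subgroup_conj_class G K"
    by (rule inj_onD)
      (use assms in \<open>auto simp: non_self_normalizing_def card_image_subgroup_conj_class\<close>)
  then have "K \<in> subgroup_conj_class G H"
    using subgroup_conj_class_self K by (simp add: non_self_normalizing_def)
  then show ?thesis by (auto simp: subgroup_conj_class_eq)
qed

lemma non_self_normalizing_p_subgroup:
  assumes p: "prime p" and K: "subgroup K G" "card K = p ^ n" and "n > 0" "p ^ Suc n dvd order G"
  shows "non_self_normalizing G K"
proof -
  obtain P where P: "P \<in> sylow_subgroups G p" "K \<subseteq> P" using p_subgroup_subset_sylow[OF p K] .
  note P_sylow = sylow_subgroupsD[OF P(1)]
  have "Suc n \<le> multiplicity p (order G)"
    using assms(5) p not_prime_unit order_pos by (intro multiplicity_geI) auto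
  then have "card K \<noteq> card P" using K(2) P_sylow(2) prime_power_inj[OF p] by fastforce
  then have "K \<subset> P" using P(2) by auto
  then have "normalizer G K \<noteq> K" using p_subgroup_normalizer_grows[OF p P_sylow(1,2) K(1)] by blast
  moreover have "K \<noteq> {\<one>}" by (rule p_subgroup_nontrivial[OF p K(1,2) \<open>n > 0\<close>])
  ultimately show ?thesis using K(1) by (simp add: non_self_normalizing_def)
qed

lemma prime_power_mem_non_self_normalizing_orders:
  assumes "prime p" "n > 0" "p ^ Suc n dvd order G"
  shows "p ^ n \<in> non_self_normalizing_orders G"
proof -
  have "p ^ n dvd order G" using assms(3) by (metis dvd_mult_right power_Suc)
  then obtain K where K: "subgroup K G" "card K = p ^ n"
    using exists_prime_power_subgroup[OF assms(1)] by blast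
  then show ?thesis using non_self_normalizing_ordersI[OF non_self_normalizing_p_subgroup] assms
    by metis
qed

end

lemma (in group) exists_least_prime_divisor:
  assumes "order G > 1"
  obtains r where "prime r" "r dvd order G" "\<forall>q. prime q \<longrightarrow> q dvd order G \<longrightarrow> r \<le> q"
proof -
  obtain p where "prime p \<and> p dvd order G" using assms prime_factor_nat[of "order G"] by auto
  from LeastI[of "\<lambda>p. prime p \<and> p dvd order G", OF this] show ?thesis
    using that Least_le[of "\<lambda>p. prime p \<and> p dvd order G"] by blast
qed

context nonabelian_simple_group
begin

lemma non_self_normalizing_abelian_p_subgroup:
  assumes p: "prime p" and K: "subgroup K G" "card K = p ^ n" "K \<subseteq> centralizer G K" and "n > 0"
  shows "non_self_normalizing G K"
proof (cases "p ^ Suc n dvd order G")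
  case True
  then show ?thesis using non_self_normalizing_p_subgroup[OF p K(1,2)] \<open>n > 0\<close> by blast
next
  case False
  have dvd: "p ^ n dvd order G" using card_subgroup_dvd_order[OF K(1)] K(2) by simp
  then have "multiplicity p (order G) = n" using False by (intro multiplicity_eqI)
  then have "K \<in> sylow_subgroups G p" using K by (simp add: sylow_subgroups_def)
  moreover have "p dvd order G" using dvd \<open>n > 0\<close> by (metis dvd_power dvd_trans)
  ultimately have "\<not> normalizer G K \<subseteq> centralizer G K"
    using abelian_sylow_normalizer_not_subset_centralizer[OF p _ _ K(3)] by blast
  moreover have "K \<noteq> {\<one>}" by (rule p_subgroup_nontrivial[OF p K(1,2) \<open>n > 0\<close>])
  ultimately show ?thesis using K(1,3) by (auto simp: non_self_normalizing_def)
qed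

lemma non_self_normalizing_order_prime_or_square:
  assumes "prime p" "k \<in> {1, 2}" "subgroup K G" "card K = p ^ k"
  shows "non_self_normalizing G K"
proof -
  have "K \<subseteq> centralizer G K"
    using order_prime_abelian[OF assms(1,3)] order_prime_square_abelian[OF assms(1,3)] assms(2,4)
    by auto
  then show ?thesis using non_self_normalizing_abelian_p_subgroup[OF assms(1,3,4)] assms(2) by auto
qed

lemma small_prime_powers_subset_non_self_normalizing_orders:
  "(\<lambda>(p, k). p ^ k) ` small_prime_power_divisors (order G) \<subseteq> non_self_normalizing_orders G"
proof clarify
  fix p k assume "(p, k) \<in> small_prime_power_divisors (order G)"
  then have pk: "prime p" "k \<in> {1, 2}" "p ^ k dvd order G"
    by (auto simp: small_prime_power_divisors_def)
  then obtain K where "subgroup K G" "card K = p ^ k" using exists_prime_power_subgroup by blast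
  then show "p ^ k \<in> non_self_normalizing_orders G"
    using non_self_normalizing_order_prime_or_square[OF pk(1,2)] non_self_normalizing_ordersI by metis
qed

lemma finite_small_prime_power_divisors: "finite (small_prime_power_divisors (order G))"
  using small_prime_powers_subset_non_self_normalizing_orders finite_non_self_normalizing_orders
    inj_on_power_small_prime_power_divisors by (rule inj_on_finite[rotated])

lemma card_small_prime_power_divisors_le:
  "card (small_prime_power_divisors (order G)) \<le> card (non_self_normalizing_orders G)"
  using card_inj_on_le[OF inj_on_power_small_prime_power_divisors
      small_prime_powers_subset_non_self_normalizing_orders] by simp

lemma least_prime_abelian_sylow:
  assumes "prime r" "r dvd order G" and least: "\<forall>q. prime q \<longrightarrow> q dvd order G \<longrightarrow> r \<le> q"
    and "P \<in> sylow_subgroups G r" "P \<subseteq> centralizer G P"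
  obtains q j where "prime q" "r < q" "q dvd card (normalizer G P)"
    and "1 \<le> j" "j \<le> multiplicity r (order G)" "q dvd r ^ j - 1"
proof -
  obtain q j where qj: "prime q" "q \<noteq> r" "q dvd card (normalizer G P)"
      "1 \<le> j" "j \<le> multiplicity r (order G)" "q dvd r ^ j - 1"
    using abelian_sylow_normalizer_prime[OF assms(1,2,4,5)] .
  have "card (normalizer G P) dvd order G"
    by (intro card_subgroup_dvd_order normalizer_imp_subgroup sylow_subgroupsD(3)[OF assms(4)])
  then have "r < q" using least qj(1-3) dvd_trans by (metis le_neq_implies_less)
  then show ?thesis using that qj by blast
qed

lemma least_prime_square_dvd_order:
  assumes r: "prime r" "r dvd order G" and least: "\<forall>q. prime q \<longrightarrow> q dvd order G \<longrightarrow> r \<le> q"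
  shows "r ^ 2 dvd order G"
proof (rule ccontr)
  assume "\<not> r ^ 2 dvd order G"
  then have mult: "multiplicity r (order G) = 1" by (rule multiplicity_eq_1_if_square_not_dvd[OF r(2)])
  obtain P where P: "P \<in> sylow_subgroups G r" using exists_sylow_subgroup[OF r(1)] .
  then have "P \<subseteq> centralizer G P"
    using order_prime_abelian[OF r(1) sylow_subgroupsD(1)[OF P]] sylow_subgroupsD(2)[OF P] mult by simp
  then obtain q j where "r < q" "1 \<le> j" "j \<le> multiplicity r (order G)" "q dvd r ^ j - 1"
    using least_prime_abelian_sylow[OF r least P] by blast
  then have "q dvd r - 1" "r < q" using mult by auto
  then show False using prime_gt_1_nat[OF r(1)] by (auto dest!: dvd_imp_le)
qed

lemma least_prime_sylow_order_square:
  assumes r: "prime r" "r dvd order G" and least: "\<forall>q. prime q \<longrightarrow> q dvd order G \<longrightarrow> r \<le> q"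
    and mult: "multiplicity r (order G) = 2" and P: "P \<in> sylow_subgroups G r"
  shows "r = 2" "3 dvd card (normalizer G P)"
proof -
  have "P \<subseteq> centralizer G P"
    using order_prime_square_abelian[OF r(1) sylow_subgroupsD(1)[OF P]] sylow_subgroupsD(2)[OF P] mult
    by simp
  then obtain q j where q: "prime q" "r < q" "q dvd card (normalizer G P)"
    and j: "1 \<le> j" "j \<le> multiplicity r (order G)" "q dvd r ^ j - 1"
    using least_prime_abelian_sylow[OF r least P] by blast
  have "j \<noteq> 1" using j(3) q(2) prime_gt_1_nat[OF r(1)] by (auto dest!: dvd_imp_le)
  then have "j = 2" using j(1,2) mult by simp
  then have "q dvd r ^ 2 - 1" using j(3) by simp
  note r_q = prime_dvd_prime_square_minus_one[OF q(1) r(1) q(2) this]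
  show "r = 2" by (rule r_q(1))
  show "3 dvd card (normalizer G P)" using q(3) r_q(2) by simp
qed

lemma card_small_prime_power_divisors_ge_4: "4 \<le> card (small_prime_power_divisors (order G))"
proof -
  let ?E = "small_prime_power_divisors (order G)"
  obtain r where r: "prime r" "r dvd order G" and least: "\<forall>q. prime q \<longrightarrow> q dvd order G \<longrightarrow> r \<le> q"
    using exists_least_prime_divisor[OF order_gt_one] .
  have r_mem: "(r, 1) \<in> ?E" "(r, 2) \<in> ?E"
    using r least_prime_square_dvd_order[OF r least] by (auto simp: small_prime_power_divisors_def)
  note factors = prime_factors_iff_small_prime_power_divisors[OF order_pos]
  have two_more: "4 \<le> card ?E" if "x \<in> ?E" "y \<in> ?E" "x \<noteq> y" "fst x \<noteq> r" "fst y \<noteq> r" for x y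
  proof -
    have "card {(r, 1), (r, 2), x, y} = 4" using that by (auto simp: card_insert_if)
    then show ?thesis using card_mono[OF finite_small_prime_power_divisors, of "{(r, 1), (r, 2), x, y}"]
        r_mem that by simp
  qed
  have factorization: "order G = (\<Prod>p\<in>prime_factors (order G). p ^ multiplicity p (order G))"
    by (rule prime_factorization_nat) simp
  have r_factor: "r \<in> prime_factors (order G)" using r by (simp add: prime_factors_dvd)
  have "prime_factors (order G) \<noteq> {r}" using factorization order_not_prime_power[OF r(1)] by auto
  then obtain q where q: "q \<in> prime_factors (order G)" "q \<noteq> r" using r_factor by blast
  show ?thesis
  proof (cases "\<exists>p\<in>prime_factors (order G). p \<noteq> r \<and> p \<noteq> q")
    case True
    then obtain p where "p \<in> prime_factors (order G)" "p \<noteq> r" "p \<noteq> q" by blast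
    then show ?thesis using two_more[of "(q, 1)" "(p, 1)"] factors[of q] factors[of p] q by simp
  next
    case False
    then have "prime_factors (order G) = {r, q}" using r_factor q(1) by blast
    then have "order G = r ^ multiplicity r (order G) * q ^ multiplicity q (order G)"
      using factorization q(2) by simp
    then have "multiplicity q (order G) \<noteq> 1"
      using order_not_prime_power_times_prime[OF r(1) _ q(2)[symmetric]] q(1)
      by (metis in_prime_factors_imp_prime power_one_right)
    then have "q ^ 2 dvd order G" using multiplicity_eq_1_if_square_not_dvd[of q] q(1) by blast
    then have "(q, 2) \<in> ?E" using q(1) by (auto simp: small_prime_power_divisors_def)
    then show ?thesis using two_more[of "(q, 1)" "(q, 2)"] factors[of q] q by simp
  qed
qed

end

section \<open>Nonabelian simple groups with four orders of non-self-normalizing subgroups\<close>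

context nonabelian_simple_group
begin

lemma card_non_self_normalizing_orders_ge_4: "4 \<le> card (non_self_normalizing_orders G)"
  using card_small_prime_power_divisors_ge_4 card_small_prime_power_divisors_le by (rule order_trans)

lemma card_non_self_normalizing_orders_eq_4:
  assumes "card (non_self_normalizing_orders G) = 4"
  shows "card (small_prime_power_divisors (order G)) = 4"
    and "non_self_normalizing_orders G = (\<lambda>(p, k). p ^ k) ` small_prime_power_divisors (order G)"
proof -
  show card: "card (small_prime_power_divisors (order G)) = 4"
    using card_small_prime_power_divisors_ge_4 card_small_prime_power_divisors_le assms by simp
  show "non_self_normalizing_orders G = (\<lambda>(p, k). p ^ k) ` small_prime_power_divisors (order G)"
    using card_seteq[OF _ small_prime_powers_subset_non_self_normalizing_orders] assms card
      card_image[OF inj_on_power_small_prime_power_divisors, of "order G"] by simp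
qed

lemma multiplicity_least_prime_eq_2:
  assumes orders: "card (non_self_normalizing_orders G) = 4"
    and conj: "\<And>H K. non_self_normalizing G H \<Longrightarrow> non_self_normalizing G K \<Longrightarrow> card H = card K \<Longrightarrow>
      \<exists>g\<in>carrier G. K = conj_set G g H"
    and r: "prime r" "r dvd order G" and least: "\<forall>q. prime q \<longrightarrow> q dvd order G \<longrightarrow> r \<le> q"
  shows "multiplicity r (order G) = 2"
proof -
  have cube: "r ^ 3 \<notin> non_self_normalizing_orders G"
    unfolding card_non_self_normalizing_orders_eq_4(2)[OF orders]
    using r(1) by (auto simp: small_prime_power_divisors_def prime_power_inj''
        dest: prime_power_inj'[OF r(1), of _ 3 1, simplified])
  have "2 \<le> multiplicity r (order G)"
    using least_prime_square_dvd_order[OF r least] r(1) not_prime_unit order_pos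
    by (intro multiplicity_geI) auto
  moreover have "\<not> 4 \<le> multiplicity r (order G)"
    using prime_power_mem_non_self_normalizing_orders[OF r(1), of 3] cube
      multiplicity_dvd'[of 4 r "order G"]
    by auto
  moreover have "multiplicity r (order G) \<noteq> 3"
  proof
    assume mult: "multiplicity r (order G) = 3"
    obtain P where P: "P \<in> sylow_subgroups G r" using exists_sylow_subgroup[OF r(1)] .
    note P_sylow = sylow_subgroupsD[OF P, unfolded mult]
    have "P \<noteq> {\<one>}" using p_subgroup_nontrivial[OF r(1) P_sylow(1,2)] by simp
    then have "normalizer G P = P"
      using cube non_self_normalizing_ordersI[of P] P_sylow(1,2)
      by (auto simp: non_self_normalizing_def)
    then have "P \<subseteq> centralizer G P"
      using self_normalizing_sylow_order_prime_cube_abelian[OF r(1) P P_sylow(2)] conj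
        non_self_normalizing_order_prime_or_square[OF r(1), of 2] by simp
    then have "non_self_normalizing G P"
      using non_self_normalizing_abelian_p_subgroup[OF r(1) P_sylow(1,2)] by simp
    then show False using non_self_normalizing_ordersI[of P] P_sylow(2) cube by simp
  qed
  ultimately show ?thesis by linarith
qed

lemma order_not_four_times_three_power:
  assumes "2 \<le> b"
  shows "order G \<noteq> 4 * 3 ^ b"
proof
  assume ord: "order G = 4 * 3 ^ b"
  have three: "prime (3::nat)" by simp
  obtain Q where Q: "subgroup Q G" "card Q = 3 ^ b"
    using exists_prime_power_subgroup[OF three, of b] ord by auto
  then have index: "card (rcosets Q) = 4" using lagrange[OF Q(1)] ord by simp
  then have "Q \<noteq> carrier G" using card_rcosets_eq_1_iff[OF Q(1)] by auto
  then have "order G \<le> fact 4" using order_le_fact_index[OF Q(1)] index by simp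
  moreover have "(9::nat) \<le> 3 ^ b" using power_increasing[OF assms, of "3::nat"] by simp
  ultimately show False using ord by (simp add: fact_numeral)
qed

lemma normalizer_card_neq_order:
  assumes "subgroup H G" "card H \<noteq> 1" "card H \<noteq> order G"
  shows "card (normalizer G H) \<noteq> order G"
  using assms normalizer_proper[OF assms(1)] card_one_subgroup_iff[OF assms(1)]
    card_subgroup_eq_order_iff[OF assms(1)]
    card_subgroup_eq_order_iff[OF normalizer_imp_subgroup[OF subgroup.subset[OF assms(1)]]] by blast

lemma order_twelve_times_prime:
  assumes q: "prime q" "5 \<le> q" and ord: "order G = 12 * q"
  shows "q = 5"
proof -
  have "\<not> q dvd 12"
  proof
    assume "q dvd 12"
    then have "q dvd 2 * (2 * 3)" by simp
    then have "q dvd 2 \<or> q dvd 3" using q(1) by (metis prime_dvd_mult_nat)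
    then show False using q(2) by (auto dest!: dvd_imp_le)
  qed
  then have mult: "multiplicity q (order G) = 1"
    using multiplicity_prime_power_times[OF q(1), of 12 1] ord by (simp add: mult.commute)
  obtain Q where Q: "Q \<in> sylow_subgroups G q" using exists_sylow_subgroup[OF q(1)] .
  then have Q_facts: "subgroup Q G" "card Q = q" using sylow_subgroupsD(1,2) mult by force+
  have N: "subgroup (normalizer G Q) G"
    by (rule normalizer_imp_subgroup[OF subgroup.subset[OF Q_facts(1)]])
  define n where "n = card (sylow_subgroups G q)"
  obtain k where k: "card (normalizer G Q) = q * k"
    using card_subgroup_dvd[OF Q_facts(1) N subgroup_subset_normalizer[OF Q_facts(1)]] Q_facts(2)
    by auto
  have n_times_k: "n * k = 12"
    using card_sylow_subgroups[OF q(1) Q] k ord q(2) by (simp add: n_def ac_simps)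
  have "non_self_normalizing G Q"
    using non_self_normalizing_order_prime_or_square[OF q(1), of 1] Q_facts by simp
  then have "card (normalizer G Q) \<noteq> card Q"
    using card_subset_eq[of "normalizer G Q" Q] N subgroup_subset_normalizer[OF Q_facts(1)]
    by (auto simp: non_self_normalizing_def)
  then have "k \<noteq> 1" using k Q_facts(2) by simp
  have "card (normalizer G Q) \<noteq> order G"
    using normalizer_card_neq_order[OF Q_facts(1)] Q_facts(2) q(2) ord by simp
  then have "n \<noteq> 1" using k n_times_k ord by (intro notI) (simp add: mult.commute)
  moreover have "n \<noteq> 0" "k \<noteq> 0" using n_times_k by (intro notI; simp)+
  ultimately have n: "1 < n" "n \<le> 6" using n_times_k \<open>k \<noteq> 1\<close> mult_le_mono2[of 2 k n] by auto
  have "q dvd n - 1"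
    using card_sylow_subgroups_cong[OF q(1)] n(1) by (simp add: n_def cong_altdef_nat)
  then have "q \<le> n - 1" using n(1) by (intro dvd_imp_le) auto
  then show ?thesis using q(2) n(2) by linarith
qed

lemma order_eq_60:
  assumes "card (small_prime_power_divisors (order G)) = 4"
    and "multiplicity 2 (order G) = 2" "3 dvd order G"
  shows "order G = 60"
  using order_pos assms
proof (cases rule: four_times_three_power_or_twelve_times_prime)
  case (three_power b)
  then show ?thesis using order_not_four_times_three_power by blast
next
  case (prime q)
  then show ?thesis using order_twelve_times_prime by simp
qed

lemma card_rcosets_normalizer_eq_5:
  assumes ord: "order G = 60" and P: "subgroup P G" "card P = 4" and three: "3 dvd card (normalizer G P)"
  shows "card (rcosets (normalizer G P)) = 5"
proof -
  have N: "subgroup (normalizer G P) G" by (rule normalizer_imp_subgroup[OF subgroup.subset[OF P(1)]])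
  have "4 dvd card (normalizer G P)"
    using card_subgroup_dvd[OF P(1) N subgroup_subset_normalizer[OF P(1)]] P(2) by simp
  then have "12 dvd card (normalizer G P)" using three by presburger
  then obtain l where l: "card (normalizer G P) = 12 * l" by auto
  then have "l * card (rcosets (normalizer G P)) = 5" using lagrange[OF N] ord by simp
  moreover have "card (rcosets (normalizer G P)) \<noteq> 1"
    using normalizer_card_neq_order[OF P(1)] P(2) ord lagrange[OF N] by auto
  moreover have "prime (5::nat)" by simp
  ultimately show ?thesis by (metis dvd_triv_right prime_nat_iff)
qed

lemma D_num_eq_4_imp_iso_alt_group_5:
  assumes "D_num G = 4"
  shows "G \<cong> alt_group 5"
proof -
  have orders: "card (non_self_normalizing_orders G) = 4"
    using card_non_self_normalizing_orders_le_D_num card_non_self_normalizing_orders_ge_4 assms by simp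
  then have conj: "\<exists>g\<in>carrier G. K = conj_set G g H"
    if "non_self_normalizing G H" "non_self_normalizing G K" "card H = card K" for H K
    using non_self_normalizing_conj_if_card_eq that assms by simp
  obtain r where r: "prime r" "r dvd order G" and least: "\<forall>q. prime q \<longrightarrow> q dvd order G \<longrightarrow> r \<le> q"
    using exists_least_prime_divisor[OF order_gt_one] .
  have mult: "multiplicity r (order G) = 2"
    by (rule multiplicity_least_prime_eq_2[OF orders conj r least])
  obtain P where P: "P \<in> sylow_subgroups G r" using exists_sylow_subgroup[OF r(1)] .
  have r_eq: "r = 2" and three: "3 dvd card (normalizer G P)"
    using least_prime_sylow_order_square[OF r least mult P] .
  note P_sylow = sylow_subgroupsD[OF P, unfolded mult, unfolded r_eq]
  have N: "subgroup (normalizer G P) G" by (rule normalizer_imp_subgroup[OF P_sylow(3)])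
  have ord: "order G = 60"
    using order_eq_60 card_non_self_normalizing_orders_eq_4(1)[OF orders] mult r_eq
      dvd_trans[OF three card_subgroup_dvd_order[OF N]] by simp
  have index: "card (rcosets (normalizer G P)) = 5"
    by (rule card_rcosets_normalizer_eq_5[OF ord P_sylow(1) _ three]) (simp add: P_sylow(2))
  then have "normalizer G P \<noteq> carrier G" using card_rcosets_eq_1_iff[OF N] by auto
  then obtain \<phi> where "\<phi> \<in> hom G (sym_group 5)" "inj_on \<phi> (carrier G)"
    using embeds_sym_group_index[OF N] index by metis
  then show ?thesis by (rule iso_alt_group) (simp add: ord fact_numeral)
qed

end

section \<open>Reduction to simple groups\<close>

context finite_group
begin

lemma non_self_normalizing_restrict:
  assumes N: "subgroup N G" and H: "non_self_normalizing (G\<lparr>carrier := N\<rparr>) H"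
  shows "non_self_normalizing G H"
  using H normalizer_restrict[OF N, of H]
  by (auto simp: non_self_normalizing_def subgroup_restrict_iff[OF N])

lemma non_self_normalizing_card_less:
  assumes "non_self_normalizing G H"
  shows "card H < order G"
proof -
  have H: "subgroup H G" "normalizer G H \<noteq> H" using assms by (simp_all add: non_self_normalizing_def)
  then have "H \<noteq> carrier G" using subgroup_subset_normalizer[OF H(1)] mem_normalizer[of H] by auto
  then have "H \<subset> carrier G" using subgroup.subset[OF H(1)] by blast
  then show ?thesis unfolding order_def by (intro psubset_card_mono) simp_all
qed

lemma non_self_normalizing_normal_subgroup:
  assumes "N \<lhd> G" "N \<noteq> {\<one>}" "N \<noteq> carrier G"
  shows "non_self_normalizing G N"
  using assms normal_iff_normalizer by (auto simp: non_self_normalizing_def)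

lemma card_non_self_normalizing_orders_normal_subgroup_less:
  assumes "N \<lhd> G" "N \<noteq> {\<one>}" "N \<noteq> carrier G"
  shows "card (non_self_normalizing_orders (G\<lparr>carrier := N\<rparr>)) < card (non_self_normalizing_orders G)"
proof -
  have N: "subgroup N G" by (rule normal_imp_subgroup[OF assms(1)])
  interpret N: finite_group "G\<lparr>carrier := N\<rparr>" by (rule finite_group_restrict[OF N])
  have "non_self_normalizing_orders (G\<lparr>carrier := N\<rparr>) \<subseteq> non_self_normalizing_orders G"
    using non_self_normalizing_restrict[OF N] by (auto simp: non_self_normalizing_orders_def)
  moreover have "card N \<in> non_self_normalizing_orders G"
    by (rule non_self_normalizing_ordersI[OF non_self_normalizing_normal_subgroup[OF assms]])
  moreover have "card N \<notin> non_self_normalizing_orders (G\<lparr>carrier := N\<rparr>)"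
    using N.non_self_normalizing_card_less by (force simp: non_self_normalizing_orders_def order_def)
  ultimately show ?thesis by (intro psubset_card_mono) auto
qed

lemma finite_group_quotient:
  assumes "M \<lhd> G"
  shows "finite_group (G Mod M)"
  using normal.factorgroup_is_group[OF assms]
  by (simp add: finite_group_def finite_group_axioms_def carrier_FactGroup)

lemma card_Union_quotient_subgroup:
  assumes M: "M \<lhd> G" and K: "subgroup K (G Mod M)"
  shows "card (\<Union>K) = card M * card K"
proof -
  interpret M: normal M G by (rule M)
  have "M \<subseteq> \<Union>K" using subgroup.one_closed[OF K] by auto
  then show ?thesis
    using lagrange_restrict[OF M.subgroup_axioms M.factgroup_subgroup_union_subgroup[OF K]]
      M.factgroup_subgroup_union_factor[OF K] by (simp add: mult.commute)
qed

lemma non_self_normalizing_quotient: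
  assumes M: "M \<lhd> G" and K: "non_self_normalizing (G Mod M) K"
  shows "non_self_normalizing G (\<Union>K)"
proof -
  interpret M: normal M G by (rule M)
  interpret Q: finite_group "G Mod M" by (rule finite_group_quotient[OF M])
  interpret h: group_hom G "G Mod M" "\<lambda>x. M #> x"
    using M.r_coset_hom_Mod by (simp add: group_hom_def group_hom_axioms_def Q.is_group is_group)
  have K_facts: "subgroup K (G Mod M)" "K \<noteq> {\<one>\<^bsub>G Mod M\<^esub>}" "normalizer (G Mod M) K \<noteq> K"
    using K by (auto simp: non_self_normalizing_def)
  have U: "subgroup (\<Union>K) G" by (rule M.factgroup_subgroup_union_subgroup[OF K_facts(1)])
  note U_carrier = subgroup.subset[OF U]
  note mem = M.factgroup_subgroup_union_char[OF K_facts(1)]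
  obtain u where u: "u \<in> normalizer (G Mod M) K" "u \<notin> K"
    using K_facts(3) Q.subgroup_subset_normalizer[OF K_facts(1)] by blast
  then have u_mem: "u \<in> carrier (G Mod M)" "conj_set (G Mod M) u K = K"
    using Q.mem_normalizer[OF subgroup.subset[OF K_facts(1)]] by auto
  then obtain x where x: "x \<in> carrier G" "u = M #> x" by (auto simp: carrier_FactGroup)
  have "conj_set G x (\<Union>K) \<subseteq> \<Union>K"
  proof
    fix y assume "y \<in> conj_set G x (\<Union>K)"
    then obtain v where v: "v \<in> \<Union>K" "y = x \<otimes> v \<otimes> inv x" by (auto simp: conj_set_def)
    have v_mem: "v \<in> carrier G" "M #> v \<in> K" using mem v(1) by auto
    have "M #> y = (M #> x) \<otimes>\<^bsub>G Mod M\<^esub> (M #> v) \<otimes>\<^bsub>G Mod M\<^esub> inv\<^bsub>G Mod M\<^esub> (M #> x)"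
      using v(2) v_mem(1) x(1) h.hom_mult[of "x \<otimes> v" "inv x"] h.hom_mult[of x v] h.hom_inv[of x] by simp
    then have "M #> y \<in> K" using v_mem(2) u_mem(2) x(2) by (auto simp: conj_set_def)
    then show "y \<in> \<Union>K" using mem v_mem(1) x(1) v(2) by auto
  qed
  then have "x \<in> normalizer G (\<Union>K)" by (rule normalizer_eqI[OF U_carrier x(1)])
  moreover have "x \<notin> \<Union>K" using mem x u(2) by auto
  moreover have "\<Union>K \<noteq> {\<one>}"
  proof
    assume "\<Union>K = {\<one>}"
    then have "card K = 1" using card_Union_quotient_subgroup[OF M K_facts(1)] by simp
    then show False using Q.card_one_subgroup_iff[OF K_facts(1)] K_facts(2) by simp
  qed
  ultimately show ?thesis using U by (auto simp: non_self_normalizing_def)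
qed

lemma quotient_orders_subset_non_self_normalizing_orders:
  assumes M: "M \<lhd> G"
  shows "(\<lambda>k. card M * k) ` non_self_normalizing_orders (G Mod M) \<subseteq> non_self_normalizing_orders G"
  using non_self_normalizing_ordersI[OF non_self_normalizing_quotient[OF M]]
    card_Union_quotient_subgroup[OF M]
  by (auto simp: non_self_normalizing_orders_def non_self_normalizing_def)

lemma card_non_self_normalizing_orders_quotient:
  assumes M: "M \<lhd> G"
  shows "card (non_self_normalizing_orders (G Mod M)) \<le> card (non_self_normalizing_orders G)"
    and "M \<noteq> {\<one>} \<Longrightarrow> M \<noteq> carrier G \<Longrightarrow>
      card (non_self_normalizing_orders (G Mod M)) < card (non_self_normalizing_orders G)"
proof -
  interpret Q: finite_group "G Mod M" by (rule finite_group_quotient[OF M])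
  let ?lift = "(\<lambda>k. card M * k) ` non_self_normalizing_orders (G Mod M)"
  have card_M_pos: "card M > 0" by (rule card_subgroup_pos[OF normal_imp_subgroup[OF M]])
  then have card_lift: "card ?lift = card (non_self_normalizing_orders (G Mod M))"
    by (intro card_image) (auto simp: inj_on_def)
  note lift = quotient_orders_subset_non_self_normalizing_orders[OF M]
  then show "card (non_self_normalizing_orders (G Mod M)) \<le> card (non_self_normalizing_orders G)"
    unfolding card_lift[symmetric] by (intro card_mono) simp
  assume "M \<noteq> {\<one>}" "M \<noteq> carrier G"
  then have "card M \<in> non_self_normalizing_orders G"
    by (intro non_self_normalizing_ordersI non_self_normalizing_normal_subgroup M)
  moreover have "card M \<notin> ?lift" using Q.one_notin_non_self_normalizing_orders card_M_pos by auto
  ultimately show "card (non_self_normalizing_orders (G Mod M)) < card (non_self_normalizing_orders G)"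
    unfolding card_lift[symmetric] using lift by (intro psubset_card_mono) auto
qed

lemma nonabelian_simple_quotient:
  assumes perfect: "derived G (carrier G) = carrier G" and M: "M \<lhd> G" "M \<noteq> carrier G"
    and maximal: "\<And>N. N \<lhd> G \<Longrightarrow> M \<subseteq> N \<Longrightarrow> N = M \<or> N = carrier G"
  shows "nonabelian_simple_group (G Mod M)"
proof -
  interpret M: normal M G by (rule M(1))
  interpret Q: finite_group "G Mod M" by (rule finite_group_quotient[OF M(1)])
  have "\<exists>u\<in>carrier (G Mod M). \<exists>v\<in>carrier (G Mod M). u \<otimes>\<^bsub>G Mod M\<^esub> v \<noteq> v \<otimes>\<^bsub>G Mod M\<^esub> u"
  proof (rule ccontr)
    assume "\<not> ?thesis"
    then have "comm_group (G Mod M)" by (intro Q.group_comm_groupI) blast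
    then have "carrier G \<subseteq> M" using derived_minimal[OF M(1)] perfect by simp
    then show False using M(2) M.subset by blast
  qed
  moreover have "order (G Mod M) > 1"
    using M.fact_group_trivial_iff[OF fin] M(2) Q.order_one_triv_iff Q.order_pos
    by (metis less_one linorder_neqE_nat less_numeral_extra(3))
  moreover have "K = carrier (G Mod M) \<or> K = {\<one>\<^bsub>G Mod M\<^esub>}" if K: "K \<lhd> G Mod M" for K
  proof -
    have K_facts: "subgroup K (G Mod M)" by (rule normal_imp_subgroup[OF K])
    have "M \<subseteq> \<Union>K" using subgroup.one_closed[OF K_facts] by auto
    then consider (whole) "\<Union>K = carrier G" | (kernel) "\<Union>K = M"
      using maximal[OF M.factgroup_subgroup_union_normal[OF K]] by blast
    then show ?thesis
    proof cases
      case whole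
      then have "M #> x \<in> K" if "x \<in> carrier G" for x
        using M.factgroup_subgroup_union_char[OF K_facts] that by blast
      then show ?thesis using subgroup.subset[OF K_facts] by (auto simp: carrier_FactGroup)
    next
      case kernel
      then have "card K = 1"
        using card_Union_quotient_subgroup[OF M(1) K_facts] card_subgroup_pos[OF M.subgroup_axioms]
        by simp
      then show ?thesis using Q.card_one_subgroup_iff[OF K_facts] by simp
    qed
  qed
  ultimately show ?thesis
    by unfold_locales (auto simp del: mult_FactGroup one_FactGroup)
qed

lemma nonabelian_simple_if_no_normal_subgroup:
  assumes perfect: "derived G (carrier G) = carrier G" and nontrivial: "carrier G \<noteq> {\<one>}"
    and "\<And>N. N \<lhd> G \<Longrightarrow> N = {\<one>} \<or> N = carrier G"
  shows "nonabelian_simple_group G"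
proof -
  have "\<exists>x\<in>carrier G. \<exists>y\<in>carrier G. x \<otimes> y \<noteq> y \<otimes> x"
  proof (rule ccontr)
    assume "\<not> ?thesis"
    then interpret comm_group G by (intro group_comm_groupI) auto
    show False using derived_eq_singleton[of "carrier G"] perfect nontrivial by simp
  qed
  moreover have "order G > 1"
    using order_pos order_one_triv_iff nontrivial
    by (metis less_one linorder_neqE_nat less_numeral_extra(3))
  ultimately show ?thesis using assms(3) by unfold_locales auto
qed

lemma exists_maximal_normal_subgroup:
  assumes "carrier G \<noteq> {\<one>}"
  obtains M where "M \<lhd> G" "M \<noteq> carrier G" "\<And>N. N \<lhd> G \<Longrightarrow> M \<subseteq> N \<Longrightarrow> N = M \<or> N = carrier G"
proof -
  let ?S = "{N. N \<lhd> G \<and> N \<noteq> carrier G}"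
  have "finite ?S"
    by (rule finite_subset[of _ "Pow (carrier G)"]) (auto dest!: normal_imp_subgroup dest: subgroup.subset)
  moreover have "?S \<noteq> {}" using one_is_normal assms by blast
  ultimately obtain M where "M \<in> ?S" "\<forall>N\<in>?S. M \<le> N \<longrightarrow> M = N"
    using finite_has_maximal[of ?S] by auto
  then show ?thesis by (intro that[of M]) auto
qed

lemma derived_not_solvable:
  assumes "\<not> solvable G"
  shows "\<not> solvable (G\<lparr>carrier := derived G (carrier G)\<rparr>)"
proof
  let ?D = "derived G (carrier G)"
  have D: "subgroup ?D G" by (rule derived_is_subgroup) simp
  assume solvable: "solvable (G\<lparr>carrier := ?D\<rparr>)"
  interpret inclusion: group_hom "G\<lparr>carrier := ?D\<rparr>" G id
    using subgroup.subset[OF D] subgroup_imp_group[OF D]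
    by (auto simp: group_hom_def group_hom_axioms_def is_group hom_def)
  have "solvable_seq G ?D"
    using inclusion.solvable_imp_solvable_img[of ?D] solvable by (simp add: solvable_def)
  then show False
    using augment_solvable_seq[OF subgroup_self] assms by (simp add: solvable_def)
qed

lemma perfect_non_self_normalizing_orders:
  assumes perfect: "derived G (carrier G) = carrier G" and nontrivial: "carrier G \<noteq> {\<one>}"
  shows "4 \<le> card (non_self_normalizing_orders G)"
    and "card (non_self_normalizing_orders G) = 4 \<Longrightarrow> nonabelian_simple_group G"
proof -
  obtain M where M: "M \<lhd> G" "M \<noteq> carrier G" "\<And>N. N \<lhd> G \<Longrightarrow> M \<subseteq> N \<Longrightarrow> N = M \<or> N = carrier G"
    using exists_maximal_normal_subgroup[OF nontrivial] by blast
  interpret S: nonabelian_simple_group "G Mod M" by (rule nonabelian_simple_quotient[OF perfect M])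
  note quotient = card_non_self_normalizing_orders_quotient[OF M(1)]
    S.card_non_self_normalizing_orders_ge_4
  then show "4 \<le> card (non_self_normalizing_orders G)" by linarith
  assume "card (non_self_normalizing_orders G) = 4"
  then have "M = {\<one>}" using quotient M(2) by linarith
  then show "nonabelian_simple_group G"
    using nonabelian_simple_if_no_normal_subgroup[OF perfect nontrivial] M(3)
      subgroup.one_closed[OF normal_imp_subgroup] by blast
qed

end

lemma nonsolvable_non_self_normalizing_orders:
  assumes "finite_group G" "\<not> solvable G"
  shows "4 \<le> card (non_self_normalizing_orders G) \<and>
    (card (non_self_normalizing_orders G) = 4 \<longrightarrow> nonabelian_simple_group G)"
  using assms
proof (induction "order G" arbitrary: G rule: less_induct)
  case less
  interpret finite_group G by (rule less.prems(1))
  let ?D = "derived G (carrier G)"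
  have nontrivial: "carrier G \<noteq> {\<one>\<^bsub>G\<^esub>}"
    using less.prems(2) solvable_seq.unity[of G] by (auto simp: solvable_def)
  show ?case
  proof (cases "?D = carrier G")
    case True
    then show ?thesis using perfect_non_self_normalizing_orders nontrivial by blast
  next
    case False
    have D: "?D \<lhd> G" by (rule derived_self_is_normal)
    have D_subgroup: "subgroup ?D G" by (rule normal_imp_subgroup[OF D])
    have nonsolvable: "\<not> solvable (G\<lparr>carrier := ?D\<rparr>)" by (rule derived_not_solvable[OF less.prems(2)])
    then have "?D \<noteq> {\<one>\<^bsub>G\<^esub>}"
      using solvable_seq.unity[of "G\<lparr>carrier := ?D\<rparr>"] by (auto simp: solvable_def)
    note D_less = card_non_self_normalizing_orders_normal_subgroup_less[OF D this False]
    have "card ?D < order G"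
      using False subgroup.subset[OF D_subgroup] unfolding order_def by (intro psubset_card_mono) auto
    then have "4 \<le> card (non_self_normalizing_orders (G\<lparr>carrier := ?D\<rparr>))"
      using less.hyps[OF _ finite_group_restrict[OF D_subgroup] nonsolvable] by (simp add: order_def)
    then show ?thesis using D_less by linarith
  qed
qed

theorem mainTheorem18:
  fixes G :: "('a, 'b) monoid_scheme"
  assumes "group G" and "finite (carrier G)" and "\<not> solvable G"
    and "D_num G = 4"
  shows "G \<cong> alt_group 5"
proof -
  interpret finite_group G
    using assms(1,2) by (simp add: finite_group_def finite_group_axioms_def)
  have "card (non_self_normalizing_orders G) = 4"
    using card_non_self_normalizing_orders_le_D_num assms(4)
      nonsolvable_non_self_normalizing_orders[OF finite_group_axioms assms(3)] by simp
  then interpret nonabelian_simple_group G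
    using nonsolvable_non_self_normalizing_orders[OF finite_group_axioms assms(3)] by blast
  show ?thesis using assms(4) by (rule D_num_eq_4_imp_iso_alt_group_5)
qed

end
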